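(* The following parameterized decision problem, MINIMUM MAXIMUM OUTDEGREE parameterized by the treewidth of the instance graph, is $\mathrm{W}[1]$-hard (under fpt-reductions). Instance: a finite simple undirected graph $G$, an edge weighting $w : E(G) \to \{1,2,3,\dots\}$ given in unary, and a positive integer $r$. Parameter: the treewidth $\mathrm{tw}(G)$ of $G$. Question: is there an orientation $\Lambda$ of $G$ such that $d^+_{G,w,\Lambda}(v) \leq r$ for every $v \in V(G)$?
   Context: All graphs are finite, simple and undirected; an edge between $u$ and $v$ is written $uv$ (equivalently $vu$). Orientations and weighted outdegree. An edge weighting of a graph $G$ is a mapping $w$ assigning to each edge of $G$ a positive integer. An orientation of $G$ is a mapping $\Lambda : E(G) \to V(G)\times V(G)$ with $\Lambda(uv) \in \{(u,v),(v,u)\}$ for each edge $uv$. The weighted outdegree of a vertex $v$ with respect to $w$ and $\Lambda$ is $$d^+_{G,w,\Lambda}(v) = \sum_{vu \in E(G),\ \Lambda(vu)=(v,u)} w(vu).$$ "Given in unary" means that the edge weights are encoded in unary, so that the size of an instance is at least the sum of all edge weights. Treewidth. A tree decomposition of a graph $G$ is a pair $(T,\chi)$ where $T$ is a tree and $\chi$ assigns to each $t \in V(T)$ a set $\chi(t) \subseteq V(G)$ such that (1) every vertex of $G$ lies in some $\chi(t)$ and, for every edge $uv \in E(G)$, there is some $t$ with $u,v \in \chi(t)$; (2) for any $t,t_1,t_2 \in V(T)$ such that $t$ lies on the path from $t_1$ to $t_2$ in $T$, the sets $\chi(t_1)\setminus\chi(t)$ and $\chi(t_2)\setminus\chi(t)$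 are disjoint. The width of $(T,\chi)$ is $\max_{t \in V(T)} |\chi(t)| - 1$, and $\mathrm{tw}(G)$ is the smallest width of a tree decomposition of $G$. Parameterized complexity. An instance of a parameterized problem is a pair $(x,k)$, where $x$ is the main part and $k$ (a non-negative integer) is the parameter. A parameterized problem $P$ fpt-reduces to a parameterized problem $Q$ if there are computable functions $f,g$ and a constant $c$ such that every instance $(x,k)$ of $P$ can be transformed in time $O(f(k)|x|^c)$ into an instance $(x',g(k))$ of $Q$ such that $(x,k)$ is a yes-instance of $P$ if and only if $(x',g(k))$ is a yes-instance of $Q$. The class $\mathrm{W}[1]$ may be taken to be the class of all parameterized decision problems that fpt-reduce to CLIQUE (instance: a graph $G$ and a non-negative integer $k$; parameter: $k$; question: does $G$ contain a clique on $k$ vertices?), which is a $\mathrm{W}[1]$-complete problem. A parameterized problem is $\mathrm{W}[1]$-hard if every problem in $\mathrm{W}[1]$ (equivalently, CLIQUE) fpt-reduces to it. *)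

theory Defs
  imports Main
begin

text \<open>An edge \<open>uv\<close> is the two-element set \<open>{u, v}\<close>.\<close>

definition simple_graph :: "'a set \<Rightarrow> 'a set set \<Rightarrow> bool" where
  "simple_graph V E \<longleftrightarrow> finite V \<and> (\<forall>e\<in>E. e \<subseteq> V \<and> card e = 2)"

definition path :: "'a set \<Rightarrow> 'a set set \<Rightarrow> 'a list \<Rightarrow> bool" where
  "path V E p \<longleftrightarrow>
     p \<noteq> [] \<and> set p \<subseteq> V \<and> distinct p \<and> successively (\<lambda>u v. {u, v} \<in> E) p"

definition cycle :: "'a set \<Rightarrow> 'a set set \<Rightarrow> 'a list \<Rightarrow> bool" where
  "cycle V E c \<longleftrightarrow> path V E c \<and> length c \<ge> 3 \<and> {last c, hd c} \<in> E"

definition tree :: "'a set \<Rightarrow> 'a set set \<Rightarrow> bool" where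
  "tree V E \<longleftrightarrow> simple_graph V E \<and> V \<noteq> {} \<and>
     (\<forall>u\<in>V. \<forall>v\<in>V. \<exists>p. path V E p \<and> hd p = u \<and> last p = v) \<and>
     (\<nexists>c. cycle V E c)"

text \<open>In a tree the path between two nodes is unique, so quantifying over all paths \<open>p\<close>
  from \<open>hd p\<close> to \<open>last p\<close> amounts to speaking about the path between these nodes.\<close>

definition tree_decomposition ::
    "'a set \<Rightarrow> 'a set set \<Rightarrow> 'b set \<Rightarrow> 'b set set \<Rightarrow> ('b \<Rightarrow> 'a set) \<Rightarrow> bool" where
  "tree_decomposition V E T F \<chi> \<longleftrightarrow>
     tree T F \<and>
     (\<forall>t\<in>T. \<chi> t \<subseteq> V) \<and>
     (\<forall>v\<in>V. \<exists>t\<in>T. v \<in> \<chi> t) \<and>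
     (\<forall>u v. {u, v} \<in> E \<longrightarrow> (\<exists>t\<in>T. u \<in> \<chi> t \<and> v \<in> \<chi> t)) \<and>
     (\<forall>p t. path T F p \<and> t \<in> set p \<longrightarrow>
        (\<chi> (hd p) - \<chi> t) \<inter> (\<chi> (last p) - \<chi> t) = {})"

text \<open>Subtraction on \<^typ>\<open>nat\<close> truncates, so the graph without vertices gets treewidth 0
  (instead of -1), which is a legitimate parameter value.\<close>

definition width :: "'b set \<Rightarrow> ('b \<Rightarrow> 'a set) \<Rightarrow> nat" where
  "width T \<chi> = Max ((\<lambda>t. card (\<chi> t)) ` T) - 1"

text \<open>Every finite tree is isomorphic to one whose nodes are natural numbers.\<close>

definition treewidth :: "'a set \<Rightarrow> 'a set set \<Rightarrow> nat" where
  "treewidth V E =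
     (LEAST k. \<exists>(T :: nat set) F \<chi>. tree_decomposition V E T F \<chi> \<and> width T \<chi> = k)"

definition edge_weighting :: "'a set set \<Rightarrow> ('a set \<Rightarrow> nat) \<Rightarrow> bool" where
  "edge_weighting E w \<longleftrightarrow> (\<forall>e\<in>E. 0 < w e)"

definition orientation :: "'a set set \<Rightarrow> ('a set \<Rightarrow> 'a \<times> 'a) \<Rightarrow> bool" where
  "orientation E \<Lambda> \<longleftrightarrow> (\<forall>u v. {u, v} \<in> E \<longrightarrow> \<Lambda> {u, v} \<in> {(u, v), (v, u)})"

definition weighted_outdegree ::
    "'a set set \<Rightarrow> ('a set \<Rightarrow> nat) \<Rightarrow> ('a set \<Rightarrow> 'a \<times> 'a) \<Rightarrow> 'a \<Rightarrow> nat" where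
  "weighted_outdegree E w \<Lambda> v = (\<Sum>u | {v, u} \<in> E \<and> \<Lambda> {v, u} = (v, u). w {v, u})"

text \<open>The machine model is the random access machine with addition, truncated subtraction and
  halving under the uniform cost measure, which simulates and is simulated by multitape Turing
  machines with polynomial overhead.  Programs are structured (a program with jumps is a single
  loop dispatching on a program counter).  The memory consists of unbounded arrays of natural
  numbers; a program mentions only finitely many of them, and they could be interleaved into one
  array.  Each assignment and each test costs one step, which is the number of elementary
  operations up to a factor depending on the program only.\<close>

datatype aexp =
    Const nat
  | Cell nat aexp
  | Plus aexp aexp
  | Minus aexp aexp
  | Half aexp

datatype com =
    Skip
  | Assign nat aexp aexp
  | Seq com com
  | IfNZ aexp com com
  | WhileNZ aexp com

type_synonym state = "nat \<Rightarrow> nat \<Rightarrow> nat"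

fun aval :: "aexp \<Rightarrow> state \<Rightarrow> nat" where
  "aval (Const n) s = n"
| "aval (Cell a e) s = s a (aval e s)"
| "aval (Plus e1 e2) s = aval e1 s + aval e2 s"
| "aval (Minus e1 e2) s = aval e1 s - aval e2 s"
| "aval (Half e) s = aval e s div 2"

text \<open>\<open>exec c s t s'\<close>: started in \<open>s\<close>, the program \<open>c\<close> halts after \<open>t\<close> steps in \<open>s'\<close>.\<close>

inductive exec :: "com \<Rightarrow> state \<Rightarrow> nat \<Rightarrow> state \<Rightarrow> bool" where
  Skip: "exec Skip s 1 s"
| Assign: "exec (Assign a i e) s 1 (s(a := (s a)(aval i s := aval e s)))"
| Seq: "exec c1 s t1 s' \<Longrightarrow> exec c2 s' t2 s'' \<Longrightarrow> exec (Seq c1 c2) s (t1 + t2) s''"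
| IfTrue: "aval b s \<noteq> 0 \<Longrightarrow> exec c1 s t s' \<Longrightarrow> exec (IfNZ b c1 c2) s (1 + t) s'"
| IfFalse: "aval b s = 0 \<Longrightarrow> exec c2 s t s' \<Longrightarrow> exec (IfNZ b c1 c2) s (1 + t) s'"
| WhileFalse: "aval b s = 0 \<Longrightarrow> exec (WhileNZ b c) s 1 s"
| WhileTrue: "aval b s \<noteq> 0 \<Longrightarrow> exec c s t1 s' \<Longrightarrow> exec (WhileNZ b c) s' t2 s'' \<Longrightarrow>
    exec (WhileNZ b c) s (1 + t1 + t2) s''"

text \<open>A string is stored as a sequence of nonzero cells followed by a zero cell.  Hence a
  string produced in an initially empty array is no longer than the running time.\<close>

definition string_cell :: "bool list \<Rightarrow> nat \<Rightarrow> nat" where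
  "string_cell x i = (if i < length x then (if x ! i then 2 else 1) else 0)"

text \<open>Input \<open>(x, k)\<close>: the string in array 0, the number in the first cell of array 1.
  Output: the string in array 2, the number in the first cell of array 3.\<close>

definition initial :: "bool list \<Rightarrow> nat \<Rightarrow> state" where
  "initial x k = (\<lambda>a i. if a = 0 then string_cell x i
                        else if a = 1 \<and> i = 0 then k else 0)"

definition has_output :: "state \<Rightarrow> bool list \<Rightarrow> nat \<Rightarrow> bool" where
  "has_output s x k \<longleftrightarrow> (\<forall>i\<le>length x. s 2 i = string_cell x i) \<and> s 3 0 = k"

definition computable :: "(nat \<Rightarrow> nat) \<Rightarrow> bool" where
  "computable f \<longleftrightarrow> (\<exists>p. \<forall>k. \<exists>t s. exec p (initial [] k) t s \<and> s 3 0 = f k)"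

record para_problem =
  instances :: "(bool list \<times> nat) set"
  yes_instances :: "(bool list \<times> nat) set"

text \<open>The size of \<open>x\<close> is taken as \<open>length x + 1\<close>, so that the empty string has positive size.\<close>

definition fpt_reduces :: "para_problem \<Rightarrow> para_problem \<Rightarrow> bool" where
  "fpt_reduces P Q \<longleftrightarrow>
     (\<exists>f g c C p. computable f \<and> computable g \<and>
        (\<forall>(x, k) \<in> instances P. \<exists>t s x'.
           exec p (initial x k) t s \<and>
           t \<le> C * (f k * (length x + 1) ^ c) \<and>
           has_output s x' (g k) \<and>
           (x', g k) \<in> instances Q \<and>
           ((x, k) \<in> yes_instances P \<longleftrightarrow> (x', g k) \<in> yes_instances Q)))"

definition unary :: "nat \<Rightarrow> bool list" where
  "unary n = replicate n True @ [False]"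

text \<open>Least significant bit first.\<close>

fun binary :: "nat \<Rightarrow> bool list" where
  "binary n = (if n = 0 then [] else odd n # binary (n div 2))"

declare binary.simps [simp del]

text \<open>As inputs, graphs have vertex set \<open>{0, \<dots>, n - 1}\<close> and are given by their adjacency
  matrix, row by row.  In a weighted graph the entry of an edge is its weight, in unary, and the
  entry of a non-edge is 0.\<close>

definition encode_graph :: "nat \<Rightarrow> nat set set \<Rightarrow> bool list" where
  "encode_graph n E =
     unary n @ concat (map (\<lambda>i. map (\<lambda>j. {i, j} \<in> E) [0..<n]) [0..<n])"

definition encode_weighted_graph :: "nat \<Rightarrow> nat set set \<Rightarrow> (nat set \<Rightarrow> nat) \<Rightarrow> bool list" where
  "encode_weighted_graph n E w =
     unary n @ concat (map (\<lambda>i. concat (map (\<lambda>j.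
       unary (if {i, j} \<in> E then w {i, j} else 0)) [0..<n])) [0..<n])"

definition clique :: "nat set set \<Rightarrow> nat set \<Rightarrow> bool" where
  "clique E S \<longleftrightarrow> (\<forall>u\<in>S. \<forall>v\<in>S. u \<noteq> v \<longrightarrow> {u, v} \<in> E)"

definition CLIQUE :: para_problem where
  "CLIQUE = \<lparr>
     instances = {(encode_graph n E, k) | n E k. simple_graph {0..<n} E},
     yes_instances = {(encode_graph n E, k) | n E k. simple_graph {0..<n} E \<and>
       (\<exists>S. S \<subseteq> {0..<n} \<and> card S = k \<and> clique E S)}\<rparr>"

definition W1 :: "para_problem set" where
  "W1 = {P. fpt_reduces P CLIQUE}"

definition W1_hard :: "para_problem \<Rightarrow> bool" where
  "W1_hard Q \<longleftrightarrow> (\<forall>P\<in>W1. fpt_reduces P Q)"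

definition MIN_MAX_OUTDEGREE_treewidth :: para_problem where
  "MIN_MAX_OUTDEGREE_treewidth = \<lparr>
     instances = {(encode_weighted_graph n E w @ binary r, treewidth {0..<n} E) | n E w r.
       simple_graph {0..<n} E \<and> edge_weighting E w \<and> 0 < r},
     yes_instances = {(encode_weighted_graph n E w @ binary r, treewidth {0..<n} E) | n E w r.
       simple_graph {0..<n} E \<and> edge_weighting E w \<and> 0 < r \<and>
       (\<exists>\<Lambda>. orientation E \<Lambda> \<and> (\<forall>v\<in>{0..<n}. weighted_outdegree E w \<Lambda> v \<le> r))}\<rparr>"

end

theory Submission
  imports Defs
begin

text \<open>CLIQUE reduces to the problem as follows.  Let the capacity of all vertices be \<open>r\<close>.  An item is an
  edge of weight \<open>r\<close>: whichever end carries it is full, so all other edges at that end are carried by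
  their other ends, which are taken from a set of \<open>O(k\<^sup>3)\<close> hubs.  Hence an item is a binary choice
  between two vectors of hub loads, and the instance asks for choices whose total does not exceed the
  capacity of any hub.  There is an item for every pair of positions \<open>i, j < k\<close> and every pair of
  vertices \<open>a, b\<close>, expressing that \<open>a\<close> and \<open>b\<close> are the clique members at these positions.  One hub
  per pair of positions forces an admissible choice, and two hubs per triple \<open>i, j, l\<close> compare the
  \<open>j\<close>-th members chosen for \<open>(i, j)\<close> and \<open>(j, l)\<close>, written in unary as loads \<open>b\<close> against \<open>L - a\<close>.
  Deleting the hubs leaves single edges, so a star is an optimal shape of a tree decomposition, and a
  disjoint clique of suitable size makes the treewidth exactly \<open>3 k\<^sup>3 + 1\<close>.

  For the running time, the entries of the adjacency matrix are given by expressions with bounded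
  sums, which are compiled to programs of polynomial cost.\<close>

subsection \<open>Machine programs\<close>

text \<open>Two features of the target problem shape the construction. The parameter of an output
  instance is its exact treewidth and has to be a function of \<open>k\<close> alone, whereas the
  weights, and with them the edges, depend on the input graph; the added clique pins the value from
  below. Moreover, all vertices share one bound, while the tests at the hubs need a much smaller
  capacity; a forced extra load at every hub makes up for the difference. Hubs can only bound sums
  from above, so equality of two chosen vertices is tested as two inequalities, with complementary
  loads in place of negative ones. Unary weights are affordable since all of them are polynomial in
  \<open>n\<close> and \<open>k\<close>. On the machine side, membership in \<open>W1\<close>
  supplies an arbitrary program that produces a CLIQUE instance. The reduction is appended to it, so
  it has to find blank memory behind that program, and its cost has to be expressed by the running
  time of that program, which also bounds the intermediate string.\<close>

definition runs :: "com \<Rightarrow> state \<Rightarrow> nat \<Rightarrow> (state \<Rightarrow> bool) \<Rightarrow> bool" where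
  "runs c s b Q \<longleftrightarrow> (\<exists>t s'. exec c s t s' \<and> t \<le> b \<and> Q s')"

lemma runs_mono:
  assumes "runs c s b Q" "b \<le> b'" "\<And>s'. Q s' \<Longrightarrow> Q' s'"
  shows "runs c s b' Q'"
  using assms unfolding runs_def by (meson order_trans)

lemma runs_Assign:
  assumes "Q (s(a := (s a)(aval i s := aval e s)))"
  shows "runs (Assign a i e) s 1 Q"
  using assms exec.Assign unfolding runs_def by blast

lemma runs_Seq:
  assumes "runs c1 s b1 (\<lambda>s'. runs c2 s' b2 Q)"
  shows "runs (Seq c1 c2) s (b1 + b2) Q"
  using assms exec.Seq unfolding runs_def by (meson add_mono)

lemma runs_If:
  assumes "aval e s \<noteq> 0 \<Longrightarrow> runs c1 s b Q" "aval e s = 0 \<Longrightarrow> runs c2 s b Q"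
  shows "runs (IfNZ e c1 c2) s (1 + b) Q"
proof (cases "aval e s = 0")
  case True
  then show ?thesis
    using assms(2) exec.IfFalse[OF True] unfolding runs_def by (meson add_left_mono)
next
  case False
  then show ?thesis
    using assms(1) exec.IfTrue[OF False] unfolding runs_def by (meson add_left_mono)
qed

text \<open>The invariant is indexed by the number of finished iterations, and the induction goes
  backwards from the exit at \<open>l\<close>; in this form the iterations may have different costs
  \<open>b i\<close>, which are summed.\<close>

lemma runs_While:
  assumes "I 0 s"
    and step: "\<And>i s. i < l \<Longrightarrow> I i s \<Longrightarrow> aval e s \<noteq> 0 \<and> runs c s (b i) (I (Suc i))"
    and exit: "\<And>s. I l s \<Longrightarrow> aval e s = 0 \<and> Q s"
  shows "runs (WhileNZ e c) s (1 + (\<Sum>i<l. 1 + b i)) Q"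
proof -
  have "runs (WhileNZ e c) s (1 + (\<Sum>i\<in>{j..<l}. 1 + b i)) Q" if "I j s" "j \<le> l" for j s
    using that(2,1)
  proof (induction j arbitrary: s rule: inc_induct)
    case base
    then show ?case
      using exit[OF base] exec.WhileFalse[of e s c] unfolding runs_def by force
  next
    case (step j)
    then obtain t s' where s': "exec c s t s'" "t \<le> b j" "I (Suc j) s'"
      using assms(2) unfolding runs_def by blast
    obtain t' s'' where "exec (WhileNZ e c) s' t' s''" "t' \<le> 1 + (\<Sum>i\<in>{Suc j..<l}. 1 + b i)" "Q s''"
      using step.IH[OF s'(3)] unfolding runs_def by blast
    moreover have "(\<Sum>i\<in>{j..<l}. 1 + b i) = 1 + b j + (\<Sum>i\<in>{Suc j..<l}. 1 + b i)"
      using step.hyps by (simp add: sum.atLeast_Suc_lessThan)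
    ultimately show ?case
      using exec.WhileTrue[of e s c t s' t' s''] s' assms(2)[of j s] step.prems step.hyps
      unfolding runs_def by force
  qed
  from this[of 0 s] assms(1) show ?thesis
    by (simp add: lessThan_atLeast0)
qed

section \<open>Memory footprint and relocation of programs\<close>

fun written_bound :: "com \<Rightarrow> nat" where
  "written_bound Skip = 0"
| "written_bound (Assign a i e) = Suc a"
| "written_bound (Seq c1 c2) = max (written_bound c1) (written_bound c2)"
| "written_bound (IfNZ e c1 c2) = max (written_bound c1) (written_bound c2)"
| "written_bound (WhileNZ e c) = written_bound c"

text \<open>Arrays from \<open>written_bound c\<close> on that start blank stay blank, which yields
  fresh memory for code appended to an unknown program.\<close>

lemma exec_unwritten:
  "exec c s t s' \<Longrightarrow> written_bound c \<le> a \<Longrightarrow> s' a = s a"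
  by (induction rule: exec.induct) auto

text \<open>One step makes at most one cell nonzero. As a string occupies nonzero cells only, this
  bounds the length of an intermediate string by the running time of the program that produced
  it.\<close>

lemma exec_nonzero_cells:
  "exec c s t s' \<Longrightarrow> finite {i. s a i \<noteq> 0} \<Longrightarrow>
     finite {i. s' a i \<noteq> 0} \<and> card {i. s' a i \<noteq> 0} \<le> card {i. s a i \<noteq> 0} + t"
proof (induction rule: exec.induct)
  case (Assign b i e s)
  let ?s' = "s(b := (s b)(aval i s := aval e s))"
  have sub: "{i. ?s' a i \<noteq> 0} \<subseteq> insert (aval i s) {i. s a i \<noteq> 0}"
    by auto
  have "card {i. ?s' a i \<noteq> 0} \<le> card (insert (aval i s) {i. s a i \<noteq> 0})"
    by (rule card_mono[OF _ sub]) (use Assign in auto)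
  also have "\<dots> \<le> card {i. s a i \<noteq> 0} + 1"
    using Assign by (simp add: card_insert_if)
  finally show ?case
    using finite_subset[OF sub] Assign by auto
qed auto

fun shift_aexp :: "nat \<Rightarrow> aexp \<Rightarrow> aexp" where
  "shift_aexp m (Const n) = Const n"
| "shift_aexp m (Cell a e) = Cell (a + m) (shift_aexp m e)"
| "shift_aexp m (Plus e1 e2) = Plus (shift_aexp m e1) (shift_aexp m e2)"
| "shift_aexp m (Minus e1 e2) = Minus (shift_aexp m e1) (shift_aexp m e2)"
| "shift_aexp m (Half e) = Half (shift_aexp m e)"

text \<open>The machine model fixes the input and output arrays; relocating all arrays by
  \<open>m\<close> lets several programs run one after another on separate memory.\<close>

fun shift_com :: "nat \<Rightarrow> com \<Rightarrow> com" where
  "shift_com m Skip = Skip"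
| "shift_com m (Assign a i e) = Assign (a + m) (shift_aexp m i) (shift_aexp m e)"
| "shift_com m (Seq c1 c2) = Seq (shift_com m c1) (shift_com m c2)"
| "shift_com m (IfNZ e c1 c2) = IfNZ (shift_aexp m e) (shift_com m c1) (shift_com m c2)"
| "shift_com m (WhileNZ e c) = WhileNZ (shift_aexp m e) (shift_com m c)"

lemma aval_shift: "aval (shift_aexp m e) s = aval e (\<lambda>a. s (a + m))"
  by (induction e) auto

lemma exec_shift:
  "exec c s t s' \<Longrightarrow> (\<lambda>a. r (a + m)) = s \<Longrightarrow>
     \<exists>r'. exec (shift_com m c) r t r' \<and> (\<lambda>a. r' (a + m)) = s' \<and> (\<forall>a<m. r' a = r a)"
proof (induction arbitrary: r rule: exec.induct)
  case (Assign a i e s)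
  let ?r = "r(a + m := (r (a + m))(aval (shift_aexp m i) r := aval (shift_aexp m e) r))"
  have "exec (shift_com m (Assign a i e)) r 1 ?r"
    using exec.Assign[of "a + m" "shift_aexp m i" "shift_aexp m e" r] by simp
  moreover have "(\<lambda>b. ?r (b + m)) = s(a := (s a)(aval i s := aval e s))"
    unfolding Assign[symmetric] by (auto simp: aval_shift fun_eq_iff)
  moreover have "\<forall>b<m. ?r b = r b"
    by simp
  ultimately show ?case
    by blast
next
  case (Seq c1 s t1 s' c2 t2 s'')
  obtain r1 where r1: "exec (shift_com m c1) r t1 r1" "(\<lambda>a. r1 (a + m)) = s'" "\<forall>a<m. r1 a = r a"
    using Seq.IH(1) Seq.prems by blast
  obtain r2 where "exec (shift_com m c2) r1 t2 r2" "(\<lambda>a. r2 (a + m)) = s''" "\<forall>a<m. r2 a = r1 a"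
    using Seq.IH(2) r1 by blast
  then show ?case
    using r1 exec.Seq[of "shift_com m c1" r t1 r1 "shift_com m c2" t2 r2] by auto
next
  case (IfTrue b s c1 t s' c2)
  obtain r1 where "exec (shift_com m c1) r t r1" "(\<lambda>a. r1 (a + m)) = s'" "\<forall>a<m. r1 a = r a"
    using IfTrue.IH IfTrue.prems by blast
  then show ?case
    using exec.IfTrue[of "shift_aexp m b" r "shift_com m c1" t r1 "shift_com m c2"]
      IfTrue.hyps(1) IfTrue.prems
    by (auto simp: aval_shift)
next
  case (IfFalse b s c2 t s' c1)
  obtain r1 where "exec (shift_com m c2) r t r1" "(\<lambda>a. r1 (a + m)) = s'" "\<forall>a<m. r1 a = r a"
    using IfFalse.IH IfFalse.prems by blast
  then show ?case
    using exec.IfFalse[of "shift_aexp m b" r "shift_com m c2" t r1 "shift_com m c1"]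
      IfFalse.hyps(1) IfFalse.prems
    by (auto simp: aval_shift)
next
  case (WhileFalse b s c)
  then show ?case
    using exec.WhileFalse[of "shift_aexp m b" r "shift_com m c"] by (auto simp: aval_shift)
next
  case (WhileTrue b s c t1 s' t2 s'')
  obtain r1 where r1: "exec (shift_com m c) r t1 r1" "(\<lambda>a. r1 (a + m)) = s'" "\<forall>a<m. r1 a = r a"
    using WhileTrue.IH(1) WhileTrue.prems by blast
  obtain r2 where "exec (shift_com m (WhileNZ b c)) r1 t2 r2" "(\<lambda>a. r2 (a + m)) = s''" "\<forall>a<m. r2 a = r1 a"
    using WhileTrue.IH(2) r1 by blast
  then show ?case
    using r1 WhileTrue.hyps(1) WhileTrue.prems exec.WhileTrue[of "shift_aexp m b" r "shift_com m c" t1 r1 t2 r2]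
    by (auto simp: aval_shift)
qed (use exec.Skip in auto)

subsection \<open>Expressions of polynomial cost\<close>

text \<open>The bounded sum is the only form of iteration. It already yields products, quotients and
  case distinctions, while the values of a fixed expression stay polynomial because the bounds of
  sums are themselves such values.\<close>

datatype fexp =
    Num nat
  | Var nat
  | Inp fexp
  | Add fexp fexp
  | Sub fexp fexp
  | Sum nat fexp fexp

fun feval :: "fexp \<Rightarrow> (nat \<Rightarrow> nat) \<Rightarrow> (nat \<Rightarrow> nat) \<Rightarrow> nat" where
  "feval (Num n) I v = n"
| "feval (Var x) I v = v x"
| "feval (Inp e) I v = I (feval e I v)"
| "feval (Add e1 e2) I v = feval e1 I v + feval e2 I v"
| "feval (Sub e1 e2) I v = feval e1 I v - feval e2 I v"
| "feval (Sum x e1 e2) I v = (\<Sum>i<feval e1 I v. feval e2 I (v(x := i)))"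

datatype oexp =
    Emit fexp
  | OSeq oexp oexp
  | OFor nat fexp oexp
  | OBin fexp

fun oeval :: "oexp \<Rightarrow> (nat \<Rightarrow> nat) \<Rightarrow> (nat \<Rightarrow> nat) \<Rightarrow> bool list" where
  "oeval (Emit e) I v = [feval e I v \<noteq> 0]"
| "oeval (OSeq o1 o2) I v = oeval o1 I v @ oeval o2 I v"
| "oeval (OFor x e p) I v = concat (map (\<lambda>i. oeval p I (v(x := i))) [0..<feval e I v])"
| "oeval (OBin e) I v = binary (feval e I v)"

text \<open>Compiled code uses array \<open>m\<close> for the input, \<open>m + 1\<close> for the variables, \<open>m + 2\<close> as a stack
  whose free part starts at \<open>d\<close>, and cell 0 of \<open>m + 3\<close> for the length of the output produced so
  far in array 2.\<close>

abbreviation "cell a i \<equiv> Cell a (Const i)"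

abbreviation "loop_up m d x c \<equiv>
  Seq (Assign (m + 1) (Const x) (Const 0))
   (WhileNZ (Minus (cell (m + 2) d) (cell (m + 1) x))
     (Seq c (Assign (m + 1) (Const x) (Plus (cell (m + 1) x) (Const 1)))))"

text \<open>For a sum the stack holds the bound at \<open>d\<close>, the outer value of the loop
  variable at \<open>d + 1\<close>, the accumulator at \<open>d + 2\<close> and the current summand
  at \<open>d + 3\<close>. Restoring the loop variable leaves the array of variables
  unchanged.\<close>

fun fcomp :: "nat \<Rightarrow> nat \<Rightarrow> fexp \<Rightarrow> com" where
  "fcomp m d (Num n) = Assign (m + 2) (Const d) (Const n)"
| "fcomp m d (Var x) = Assign (m + 2) (Const d) (cell (m + 1) x)"
| "fcomp m d (Inp e) = Seq (fcomp m d e) (Assign (m + 2) (Const d) (Cell m (cell (m + 2) d)))"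
| "fcomp m d (Add e1 e2) = Seq (fcomp m d e1) (Seq (fcomp m (d + 1) e2)
     (Assign (m + 2) (Const d) (Plus (cell (m + 2) d) (cell (m + 2) (d + 1)))))"
| "fcomp m d (Sub e1 e2) = Seq (fcomp m d e1) (Seq (fcomp m (d + 1) e2)
     (Assign (m + 2) (Const d) (Minus (cell (m + 2) d) (cell (m + 2) (d + 1)))))"
| "fcomp m d (Sum x e1 e2) = Seq (fcomp m d e1)
     (Seq (Assign (m + 2) (Const (d + 1)) (cell (m + 1) x))
     (Seq (Assign (m + 2) (Const (d + 2)) (Const 0))
     (Seq (loop_up m d x (Seq (fcomp m (d + 3) e2)
             (Assign (m + 2) (Const (d + 2)) (Plus (cell (m + 2) (d + 2)) (cell (m + 2) (d + 3))))))
     (Seq (Assign (m + 1) (Const x) (cell (m + 2) (d + 1)))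
          (Assign (m + 2) (Const d) (cell (m + 2) (d + 2)))))))"

abbreviation "put m e \<equiv>
  Seq (Assign 2 (cell (m + 3) 0) e) (Assign (m + 3) (Const 0) (Plus (cell (m + 3) 0) (Const 1)))"

text \<open>In the last case, a value minus twice its half is its parity; adding 1 gives the code of
  the least significant bit as a string cell.\<close>

fun ocomp :: "nat \<Rightarrow> nat \<Rightarrow> oexp \<Rightarrow> com" where
  "ocomp m d (Emit e) = Seq (fcomp m d e)
     (IfNZ (cell (m + 2) d) (put m (Const 2)) (put m (Const 1)))"
| "ocomp m d (OSeq o1 o2) = Seq (ocomp m d o1) (ocomp m d o2)"
| "ocomp m d (OFor x e p) = Seq (fcomp m d e)
     (Seq (Assign (m + 2) (Const (d + 1)) (cell (m + 1) x))
     (Seq (loop_up m d x (ocomp m (d + 2) p))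
          (Assign (m + 1) (Const x) (cell (m + 2) (d + 1)))))"
| "ocomp m d (OBin e) = Seq (fcomp m d e)
     (WhileNZ (cell (m + 2) d)
       (Seq (put m (Plus (Const 1) (Minus (cell (m + 2) d)
               (Plus (Half (cell (m + 2) d)) (Half (cell (m + 2) d))))))
            (Assign (m + 2) (Const d) (Half (cell (m + 2) d)))))"

text \<open>The 6 of a sum stands for two assignments before the loop, two after it, and the
  initialisation and last test of the counter; the 3 per round for test, accumulation and
  increment.\<close>

fun fcost :: "fexp \<Rightarrow> (nat \<Rightarrow> nat) \<Rightarrow> (nat \<Rightarrow> nat) \<Rightarrow> nat" where
  "fcost (Num n) I v = 1"
| "fcost (Var x) I v = 1"
| "fcost (Inp e) I v = fcost e I v + 1"
| "fcost (Add e1 e2) I v = fcost e1 I v + (fcost e2 I v + 1)"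
| "fcost (Sub e1 e2) I v = fcost e1 I v + (fcost e2 I v + 1)"
| "fcost (Sum x e1 e2) I v = fcost e1 I v + 6 +
     (\<Sum>i<feval e1 I v. fcost e2 I (v(x := i)) + 3)"

text \<open>A round of the binary loop costs 4 steps; the value itself serves as a crude bound on
  its number of digits.\<close>

fun ocost :: "oexp \<Rightarrow> (nat \<Rightarrow> nat) \<Rightarrow> (nat \<Rightarrow> nat) \<Rightarrow> nat" where
  "ocost (Emit e) I v = fcost e I v + (1 + 2)"
| "ocost (OSeq o1 o2) I v = ocost o1 I v + ocost o2 I v"
| "ocost (OFor x e p) I v = fcost e I v + 4 + (\<Sum>i<feval e I v. ocost p I (v(x := i)) + 2)"
| "ocost (OBin e) I v = fcost e I v + 1 + 4 * feval e I v"

text \<open>Stack cells below \<open>d\<close> hold pending results of enclosing expressions, so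
  compiled code may write to the stack only from \<open>d\<close> on; \<open>A\<close> lists the
  other arrays it may change.\<close>

definition frame :: "nat set \<Rightarrow> nat \<Rightarrow> nat \<Rightarrow> state \<Rightarrow> state \<Rightarrow> bool" where
  "frame A m d s s' \<longleftrightarrow>
     (\<forall>a. a \<noteq> m + 2 \<and> a \<notin> A \<longrightarrow> s' a = s a) \<and> (\<forall>j<d. s' (m + 2) j = s (m + 2) j)"

lemma runs_loop_up:
  assumes "J 0 (s(m + 1 := (s (m + 1))(x := 0)))"
    and step: "\<And>i s. i < l \<Longrightarrow> J i s \<Longrightarrow>
      runs c s (b i) (\<lambda>s'. s' (m + 1) x = i \<and> J (Suc i) (s'(m + 1 := (s' (m + 1))(x := Suc i))))"
    and inv: "\<And>i s. J i s \<Longrightarrow> s (m + 2) d = l \<and> s (m + 1) x = i"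
    and exit: "\<And>s. J l s \<Longrightarrow> Q s"
  shows "runs (loop_up m d x c) s (2 + (\<Sum>i<l. b i + 2)) Q"
proof -
  have body: "runs (Seq c (Assign (m + 1) (Const x) (Plus (cell (m + 1) x) (Const 1)))) s
      (b i + 1) (J (Suc i))" if "i < l" "J i s" for i s
    by (rule runs_Seq, rule runs_mono[OF step[OF that] le_refl], rule runs_Assign)
      (simp add: fun_upd_def)
  have "runs (WhileNZ (Minus (cell (m + 2) d) (cell (m + 1) x))
     (Seq c (Assign (m + 1) (Const x) (Plus (cell (m + 1) x) (Const 1)))))
     (s(m + 1 := (s (m + 1))(x := 0))) (1 + (\<Sum>i<l. 1 + (b i + 1))) Q"
  proof (rule runs_While[where I = J])
    show "J 0 (s(m + 1 := (s (m + 1))(x := 0)))"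
      by (rule assms(1))
  next
    fix i s assume "i < l" "J i s"
    then show "aval (Minus (cell (m + 2) d) (cell (m + 1) x)) s \<noteq> 0 \<and>
        runs (Seq c (Assign (m + 1) (Const x) (Plus (cell (m + 1) x) (Const 1)))) s (b i + 1) (J (Suc i))"
      using inv[of i s] body[of i s] by simp
  next
    fix s assume "J l s"
    then show "aval (Minus (cell (m + 2) d) (cell (m + 1) x)) s = 0 \<and> Q s"
      using inv[of l s] exit[of s] by simp
  qed
  then show ?thesis
    by (intro runs_mono[OF runs_Seq, OF runs_Assign]) (auto simp: add_ac)
qed

lemma fcomp_correct:
  "runs (fcomp m d e) s (fcost e (s m) (s (m + 1)))
     (\<lambda>s'. frame {} m d s s' \<and> s' (m + 2) d = feval e (s m) (s (m + 1)))"
proof (induction e arbitrary: s d)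
  case (Num n)
  show ?case
    unfolding fcomp.simps fcost.simps by (rule runs_Assign) (auto simp: frame_def)
next
  case (Var x)
  show ?case
    unfolding fcomp.simps fcost.simps by (rule runs_Assign) (auto simp: frame_def)
next
  case (Inp e)
  show ?case
    unfolding fcomp.simps fcost.simps
    by (rule runs_Seq, rule runs_mono[OF Inp le_refl], rule runs_Assign[THEN runs_mono])
      (auto simp: frame_def)
next
  case (Add e1 e2)
  show ?case
    unfolding fcomp.simps fcost.simps
    by (rule runs_Seq, rule runs_mono[OF Add.IH(1) le_refl], rule runs_mono, rule runs_Seq,
        rule runs_mono[OF Add.IH(2) le_refl], rule runs_Assign)
      (auto simp: frame_def)
next
  case (Sub e1 e2)
  show ?case
    unfolding fcomp.simps fcost.simps
    by (rule runs_Seq, rule runs_mono[OF Sub.IH(1) le_refl], rule runs_mono, rule runs_Seq,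
        rule runs_mono[OF Sub.IH(2) le_refl], rule runs_Assign)
      (auto simp: frame_def)
next
  case (Sum x e1 e2)
  let ?I = "s m" and ?v = "s (m + 1)"
  define l where "l = feval e1 ?I ?v"
  define J where "J i s' \<longleftrightarrow> frame {m + 1} m d s s' \<and> s' (m + 1) = ?v(x := i) \<and> s' (m + 2) d = l \<and>
      s' (m + 2) (d + 1) = ?v x \<and> s' (m + 2) (d + 2) = (\<Sum>j<i. feval e2 ?I (?v(x := j)))" for i s'
  have step: "runs (Seq (fcomp m (d + 3) e2)
        (Assign (m + 2) (Const (d + 2)) (Plus (cell (m + 2) (d + 2)) (cell (m + 2) (d + 3))))) s'
      (fcost e2 ?I (?v(x := i)) + 1)
      (\<lambda>s'. s' (m + 1) x = i \<and> J (Suc i) (s'(m + 1 := (s' (m + 1))(x := Suc i))))"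
    if "J i s'" for i s'
  proof -
    have "s' m = ?I" "s' (m + 1) = ?v(x := i)"
      using that by (auto simp: J_def frame_def)
    then have "runs (fcomp m (d + 3) e2) s' (fcost e2 ?I (?v(x := i)))
        (\<lambda>s''. frame {} m (d + 3) s' s'' \<and> s'' (m + 2) (d + 3) = feval e2 ?I (?v(x := i)))"
      using Sum.IH(2)[of "d + 3" s'] by (simp only:)
    then show ?thesis
      by (intro runs_Seq, elim runs_mono[OF _ le_refl], intro runs_Assign)
        (use that in \<open>auto simp: J_def frame_def\<close>)
  qed
  show ?case
    unfolding fcomp.simps fcost.simps l_def[symmetric]
    by (rule runs_mono, rule runs_Seq, rule runs_mono[OF Sum.IH(1) le_refl], rule runs_Seq,
        rule runs_Assign, rule runs_Seq, rule runs_Assign, rule runs_Seq,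
        rule runs_loop_up[where J = J and l = l, OF _ step], simp add: J_def frame_def l_def,
        assumption, force simp: J_def, rule runs_Seq, rule runs_Assign, rule runs_Assign)
      (auto simp: J_def frame_def add_ac l_def intro!: sum_mono)
qed

lemma frame_trans:
  assumes "frame A m d s s'" "frame B m d' s' s''" "d \<le> d'" "A \<subseteq> C" "B \<subseteq> C"
  shows "frame C m d s s''"
proof -
  have "s'' a = s a" if "a \<noteq> m + 2" "a \<notin> C" for a
  proof -
    have "a \<notin> A" "a \<notin> B"
      using that assms by auto
    then show ?thesis
      using that assms by (simp add: frame_def)
  qed
  then show ?thesis
    using assms by (simp add: frame_def)
qed

text \<open>Weaker than \<open>has_output\<close>: no terminating zero is demanded, since further
  bits may follow. The driver writes it at the end.\<close>

definition outputs :: "nat \<Rightarrow> state \<Rightarrow> bool list \<Rightarrow> bool" where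
  "outputs m s xs \<longleftrightarrow> s (m + 3) 0 = length xs \<and> (\<forall>i<length xs. s 2 i = string_cell xs i)"

lemma outputs_frame: "2 < m \<Longrightarrow> frame {} m d s s' \<Longrightarrow> outputs m s xs \<Longrightarrow> outputs m s' xs"
  by (auto simp: outputs_def frame_def)

lemma outputs_upd:
  "2 < m \<Longrightarrow> outputs m (s(Suc m := f)) xs = outputs m s xs"
  "2 < m \<Longrightarrow> outputs m (s(Suc (Suc m) := f)) xs = outputs m s xs"
  by (auto simp: outputs_def)

lemma put_correct:
  assumes "2 < m" "outputs m s xs" "aval e s = (if b then 2 else 1)"
  shows "runs (put m e) s 2 (\<lambda>s'. frame {2, m + 3} m d s s' \<and> s' (m + 2) = s (m + 2) \<and>
           outputs m s' (xs @ [b]))"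
  by (rule runs_mono, rule runs_Seq, rule runs_Assign, rule runs_Assign)
    (use assms in \<open>auto simp: outputs_def frame_def string_cell_def nth_append less_Suc_eq\<close>)

lemma runs_While_unfold:
  assumes "aval e s \<noteq> 0" "runs c s b (\<lambda>s'. runs (WhileNZ e c) s' b' Q)"
  shows "runs (WhileNZ e c) s (1 + b + b') Q"
  using assms exec.WhileTrue[OF assms(1)] unfolding runs_def
  by (meson add_mono le_refl)

lemma binary_loop_correct:
  assumes "2 < m"
  shows "s (m + 2) d = v \<Longrightarrow> outputs m s xs \<Longrightarrow>
    runs (WhileNZ (cell (m + 2) d)
       (Seq (put m (Plus (Const 1) (Minus (cell (m + 2) d)
               (Plus (Half (cell (m + 2) d)) (Half (cell (m + 2) d))))))
            (Assign (m + 2) (Const d) (Half (cell (m + 2) d))))) s (1 + 4 * v)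
      (\<lambda>s'. frame {2, m + 3} m d s s' \<and> outputs m s' (xs @ binary v))"
    (is "_ \<Longrightarrow> _ \<Longrightarrow> runs ?W s _ _")
proof (induction v arbitrary: s xs rule: less_induct)
  case (less v)
  show ?case
  proof (cases "v = 0")
    case True
    have "exec ?W s 1 s"
      by (rule exec.WhileFalse) (use less.prems True in simp)
    then show ?thesis
      using less.prems True by (auto simp: runs_def frame_def binary.simps)
  next
    case False
    let ?e = "Plus (Const 1) (Minus (cell (m + 2) d)
               (Plus (Half (cell (m + 2) d)) (Half (cell (m + 2) d))))"
    have e: "aval ?e s = (if odd v then 2 else 1)"
      using less.prems by (auto elim!: evenE oddE)
    have rest: "runs ?W s' (1 + 4 * (v div 2))
        (\<lambda>s'. frame {2, m + 3} m d s s' \<and> outputs m s' (xs @ binary v))"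
      if "frame {2, m + 3} m d s s'" "s' (m + 2) d = v div 2" "outputs m s' (xs @ [odd v])" for s'
      by (rule runs_mono[OF less.IH[OF _ that(2,3)] le_refl])
        (use False that(1) in \<open>auto simp: binary.simps[of v] intro: frame_trans\<close>)
    show ?thesis
    proof (rule runs_mono[OF runs_While_unfold[where b = "2 + 1" and b' = "1 + 4 * (v div 2)"]])
      show "aval (cell (m + 2) d) s \<noteq> 0"
        using False less.prems by simp
      show "runs (Seq (put m ?e) (Assign (m + 2) (Const d) (Half (cell (m + 2) d)))) s (2 + 1)
          (\<lambda>s'. runs ?W s' (1 + 4 * (v div 2))
            (\<lambda>s'. frame {2, m + 3} m d s s' \<and> outputs m s' (xs @ binary v)))"
        by (rule runs_Seq, rule runs_mono[OF put_correct[OF assms less.prems(2) e, of d] le_refl],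
            rule runs_Assign, rule rest)
          (use assms less.prems in \<open>auto simp: frame_def outputs_def\<close>)
      show "1 + (2 + 1) + (1 + 4 * (v div 2)) \<le> 1 + 4 * v"
        using False by presburger
    qed
  qed
qed

lemma ocomp_correct:
  assumes "2 < m"
  shows "outputs m s xs \<Longrightarrow> runs (ocomp m d p) s (ocost p (s m) (s (m + 1)))
     (\<lambda>s'. frame {2, m + 3} m d s s' \<and> outputs m s' (xs @ oeval p (s m) (s (m + 1))))"
proof (induction p arbitrary: s d xs)
  case (Emit e)
  let ?b = "feval e (s m) (s (m + 1)) \<noteq> 0"
  have "runs (IfNZ (cell (m + 2) d) (put m (Const 2)) (put m (Const 1))) s' (1 + 2)
      (\<lambda>s'. frame {2, m + 3} m d s s' \<and> outputs m s' (xs @ [?b]))"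
    if "frame {} m d s s'" "s' (m + 2) d = feval e (s m) (s (m + 1))" for s'
    by (rule runs_If; rule runs_mono[OF put_correct[OF assms outputs_frame[OF assms that(1) Emit],
            where b = ?b and d = d] le_refl])
      (use that in \<open>auto intro: frame_trans\<close>)
  then show ?case
    unfolding ocomp.simps ocost.simps oeval.simps
    by (intro runs_Seq runs_mono[OF fcomp_correct le_refl]) blast
next
  case (OSeq p1 p2)
  show ?case
    unfolding ocomp.simps ocost.simps
  proof (rule runs_Seq, rule runs_mono[OF OSeq.IH(1)[OF OSeq.prems] le_refl], elim conjE)
    fix s' assume s': "frame {2, m + 3} m d s s'" "outputs m s' (xs @ oeval p1 (s m) (s (m + 1)))"
    then have "s' m = s m" "s' (m + 1) = s (m + 1)"
      using assms by (auto simp: frame_def)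
    then show "runs (ocomp m d p2) s' (ocost p2 (s m) (s (m + 1))) (\<lambda>s'. frame {2, m + 3} m d s s' \<and>
        outputs m s' (xs @ oeval (OSeq p1 p2) (s m) (s (m + 1))))"
      by (intro runs_mono[OF OSeq.IH(2)[OF s'(2), of d, unfolded \<open>s' m = s m\<close> \<open>s' (m + 1) = s (m + 1)\<close>] le_refl])
        (auto intro: frame_trans[OF s'(1)])
  qed
next
  case (OFor x e p)
  let ?I = "s m" and ?v = "s (m + 1)"
  define l where "l = feval e ?I ?v"
  define J where "J i s' \<longleftrightarrow> frame {2, m + 3, m + 1} m d s s' \<and> s' (m + 1) = ?v(x := i) \<and>
      s' (m + 2) d = l \<and> s' (m + 2) (d + 1) = ?v x \<and>
      outputs m s' (xs @ concat (map (\<lambda>i. oeval p ?I (?v(x := i))) [0..<i]))" for i s'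
  have step: "runs (ocomp m (d + 2) p) s' (ocost p ?I (?v(x := i)))
      (\<lambda>s'. s' (m + 1) x = i \<and> J (Suc i) (s'(m + 1 := (s' (m + 1))(x := Suc i))))"
    if "J i s'" for i s'
  proof -
    have s': "s' m = ?I" "s' (m + 1) = ?v(x := i)"
      using that assms by (auto simp: J_def frame_def)
    have o': "outputs m s' (xs @ concat (map (\<lambda>i. oeval p ?I (?v(x := i))) [0..<i]))"
      using that by (simp add: J_def)
    have "runs (ocomp m (d + 2) p) s' (ocost p ?I (?v(x := i)))
      (\<lambda>s''. frame {2, m + 3} m (d + 2) s' s'' \<and>
         outputs m s'' (xs @ concat (map (\<lambda>i. oeval p ?I (?v(x := i))) [0..<Suc i])))"
      using OFor.IH[OF o', of "d + 2"] s' by (simp only: upt_Suc_append map_append concat_append le0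
        list.map concat.simps append_Nil2 append_assoc)
    then show ?thesis
      by (rule runs_mono[OF _ le_refl])
        (use that assms s' in \<open>auto simp: J_def frame_def outputs_upd simp del: upt_Suc\<close>)
  qed
  have start: "runs (fcomp m d e) s (fcost e ?I ?v)
      (\<lambda>s'. frame {} m d s s' \<and> s' (m + 2) d = l \<and> outputs m s' xs)"
    by (rule runs_mono[OF fcomp_correct le_refl])
      (use OFor.prems assms in \<open>auto simp: l_def intro: outputs_frame\<close>)
  show ?case
    unfolding ocomp.simps ocost.simps l_def[symmetric]
    by (rule runs_mono, rule runs_Seq, rule runs_mono[OF start le_refl], rule runs_Seq,
        rule runs_Assign, rule runs_Seq, rule runs_loop_up[where J = J and l = l, OF _ step],
        use assms in \<open>simp add: J_def frame_def l_def outputs_upd\<close>, assumption,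
        force simp: J_def, rule runs_Assign)
      (use assms in \<open>auto simp: J_def frame_def add_ac l_def outputs_upd intro!: sum_mono\<close>)
next
  case (OBin e)
  have "runs (WhileNZ (cell (m + 2) d)
       (Seq (put m (Plus (Const 1) (Minus (cell (m + 2) d)
               (Plus (Half (cell (m + 2) d)) (Half (cell (m + 2) d))))))
            (Assign (m + 2) (Const d) (Half (cell (m + 2) d))))) s' (1 + 4 * feval e (s m) (s (m + 1)))
      (\<lambda>s'. frame {2, m + 3} m d s s' \<and> outputs m s' (xs @ binary (feval e (s m) (s (m + 1)))))"
    if "frame {} m d s s'" "s' (m + 2) d = feval e (s m) (s (m + 1))" for s'
    by (rule runs_mono[OF binary_loop_correct[OF assms that(2) outputs_frame[OF assms that(1) OBin]] le_refl])
      (use that in \<open>auto intro: frame_trans\<close>)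
  then show ?case
    unfolding ocomp.simps ocost.simps oeval.simps add.assoc
    by (intro runs_Seq runs_mono[OF fcomp_correct le_refl]) blast
qed


section \<open>Polynomial bounds on values and costs\<close>

text \<open>Bounding by a pure power of \<open>B\<close> with \<open>2 \<le> B\<close> turns closure
  under sums and products into arithmetic of exponents.\<close>

definition poly_bounded :: "((nat \<Rightarrow> nat) \<Rightarrow> (nat \<Rightarrow> nat) \<Rightarrow> nat) \<Rightarrow> bool" where
  "poly_bounded f \<longleftrightarrow>
     (\<exists>c. \<forall>B I v. 2 \<le> B \<longrightarrow> (\<forall>i. I i \<le> B) \<longrightarrow> (\<forall>x. v x \<le> B) \<longrightarrow> f I v \<le> B ^ c)"

lemma poly_boundedI:
  "(\<And>B I v. 2 \<le> B \<Longrightarrow> (\<And>i. I i \<le> B) \<Longrightarrow> (\<And>x. v x \<le> B) \<Longrightarrow> f I v \<le> B ^ c) \<Longrightarrow> poly_bounded f"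
  unfolding poly_bounded_def by blast

lemma poly_boundedE:
  assumes "poly_bounded f"
  obtains c where
    "\<And>B I v. 2 \<le> B \<Longrightarrow> (\<And>i. I i \<le> B) \<Longrightarrow> (\<And>x. v x \<le> B) \<Longrightarrow> f I v \<le> B ^ c"
  using assms unfolding poly_bounded_def by blast

lemma poly_bounded_const: "poly_bounded (\<lambda>I v. n)"
proof (rule poly_boundedI)
  fix B :: nat assume "2 \<le> B"
  then have "2 ^ n \<le> B ^ n"
    by (simp add: power_mono)
  then show "n \<le> B ^ n"
    using less_exp[of n] by linarith
qed

lemma poly_bounded_var: "poly_bounded (\<lambda>I v. v x)"
  by (rule poly_boundedI[where c = 1]) simp

lemma poly_bounded_inp: "poly_bounded (\<lambda>I v. I (f I v))"
  by (rule poly_boundedI[where c = 1]) simp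

lemma poly_bounded_mono:
  "poly_bounded f \<Longrightarrow> (\<And>I v. g I v \<le> f I v) \<Longrightarrow> poly_bounded g"
  unfolding poly_bounded_def by (meson order_trans)

lemma poly_bounded_add:
  assumes "poly_bounded f" "poly_bounded g"
  shows "poly_bounded (\<lambda>I v. f I v + g I v)"
proof -
  obtain c where c: "\<And>B I v. 2 \<le> B \<Longrightarrow> (\<And>i. I i \<le> B) \<Longrightarrow> (\<And>x. v x \<le> B) \<Longrightarrow> f I v \<le> B ^ c"
    using poly_boundedE[OF assms(1)] by blast
  obtain d where d: "\<And>B I v. 2 \<le> B \<Longrightarrow> (\<And>i. I i \<le> B) \<Longrightarrow> (\<And>x. v x \<le> B) \<Longrightarrow> g I v \<le> B ^ d"
    using poly_boundedE[OF assms(2)] by blast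
  show ?thesis
  proof (rule poly_boundedI)
    fix B :: nat and I v :: "nat \<Rightarrow> nat"
    assume B: "2 \<le> B" "\<And>i. I i \<le> B" "\<And>x. v x \<le> B"
    have "f I v + g I v \<le> B ^ c + B ^ d"
      using add_mono[OF c[of B I v] d[of B I v]] B by blast
    also have "\<dots> \<le> B ^ (c + d) + B ^ (c + d)"
      using B(1) by (intro add_mono power_increasing) auto
    also have "\<dots> \<le> B ^ Suc (c + d)"
      using mult_right_mono[OF B(1), of "B ^ (c + d)"] by (simp only: mult_2 power_Suc)
    finally show "f I v + g I v \<le> B ^ Suc (c + d)" .
  qed
qed

lemma poly_bounded_mult:
  assumes "poly_bounded f" "poly_bounded g"
  shows "poly_bounded (\<lambda>I v. f I v * g I v)"
proof -
  obtain c where c: "\<And>B I v. 2 \<le> B \<Longrightarrow> (\<And>i. I i \<le> B) \<Longrightarrow> (\<And>x. v x \<le> B) \<Longrightarrow> f I v \<le> B ^ c"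
    using poly_boundedE[OF assms(1)] by blast
  obtain d where d: "\<And>B I v. 2 \<le> B \<Longrightarrow> (\<And>i. I i \<le> B) \<Longrightarrow> (\<And>x. v x \<le> B) \<Longrightarrow> g I v \<le> B ^ d"
    using poly_boundedE[OF assms(2)] by blast
  show ?thesis
    by (rule poly_boundedI[where c = "c + d"]) (simp add: power_add mult_mono c d)
qed

text \<open>Inside the sum the variable \<open>x\<close> ranges up to \<open>B ^ c\<close>, which
  may exceed \<open>B\<close>. The bound for the summand is therefore applied with
  \<open>B ^ Suc c\<close>, which dominates both \<open>B\<close> and \<open>B ^ c\<close>.\<close>

lemma poly_bounded_sum:
  assumes "poly_bounded f" "poly_bounded g"
  shows "poly_bounded (\<lambda>I v. \<Sum>i<f I v. g I (v(x := i)))"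
proof -
  obtain c where c: "\<And>B I v. 2 \<le> B \<Longrightarrow> (\<And>i. I i \<le> B) \<Longrightarrow> (\<And>x. v x \<le> B) \<Longrightarrow> f I v \<le> B ^ c"
    using poly_boundedE[OF assms(1)] by blast
  obtain d where d: "\<And>B I v. 2 \<le> B \<Longrightarrow> (\<And>i. I i \<le> B) \<Longrightarrow> (\<And>x. v x \<le> B) \<Longrightarrow> g I v \<le> B ^ d"
    using poly_boundedE[OF assms(2)] by blast
  show ?thesis
  proof (rule poly_boundedI)
    fix B :: nat and I v :: "nat \<Rightarrow> nat"
    assume B: "2 \<le> B" "\<And>i. I i \<le> B" "\<And>x. v x \<le> B"
    have f: "f I v \<le> B ^ c"
      using c[of B I v] B by blast
    have "B ^ 1 \<le> B ^ Suc c" "B ^ c \<le> B ^ Suc c"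
      using B(1) by (intro power_increasing; simp)+
    then have "g I (v(x := i)) \<le> (B ^ Suc c) ^ d" if "i < f I v" for i
      using B f that
      by (intro d) (auto simp del: power_Suc intro: order_trans[of _ B] order_trans[of _ "B ^ c"])
    then have "(\<Sum>i<f I v. g I (v(x := i))) \<le> f I v * (B ^ Suc c) ^ d"
      using sum_bounded_above[of "{..<f I v}" "\<lambda>i. g I (v(x := i))" "(B ^ Suc c) ^ d"] by simp
    also have "\<dots> \<le> B ^ c * (B ^ Suc c) ^ d"
      using f by simp
    also have "\<dots> = B ^ (c + Suc c * d)"
      by (simp only: power_add power_mult)
    finally show "(\<Sum>i<f I v. g I (v(x := i))) \<le> B ^ (c + Suc c * d)" .
  qed
qed

lemma poly_bounded_sum_add:
  "poly_bounded f \<Longrightarrow> poly_bounded g \<Longrightarrow>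
    poly_bounded (\<lambda>I v. \<Sum>i<f I v. g I (v(x := i)) + n)"
  by (rule poly_bounded_sum[where g = "\<lambda>I v. g I v + n"])
    (auto intro: poly_bounded_add poly_bounded_const)

lemma poly_bounded_feval: "poly_bounded (feval e)"
proof (induction e)
  case (Sub e1 e2)
  then show ?case
    by (rule_tac poly_bounded_mono[of "feval e1"]) auto
next
  case (Sum x e1 e2)
  then show ?case
    using poly_bounded_sum[of "feval e1" "feval e2" x] by simp
qed (simp_all add: poly_bounded_const poly_bounded_var poly_bounded_inp poly_bounded_add)

lemmas poly_bounded_intros = poly_bounded_const poly_bounded_add poly_bounded_mult
  poly_bounded_sum_add poly_bounded_feval

lemma poly_bounded_fcost: "poly_bounded (fcost e)"
  by (induction e) (auto intro!: poly_bounded_intros simp del: add_Suc_right add_2_eq_Suc' One_nat_def)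

lemma poly_bounded_ocost: "poly_bounded (ocost p)"
  by (induction p)
    (auto intro!: poly_bounded_intros poly_bounded_fcost simp del: add_Suc_right add_2_eq_Suc' One_nat_def)

subsection \<open>Treewidth and orientations\<close>

definition star :: "nat \<Rightarrow> nat set set" where
  "star m = {{0, i} | i. 1 \<le> i \<and> i \<le> m}"

lemma star_edge_iff: "{u, v} \<in> star m \<longleftrightarrow> (u = 0 \<and> 1 \<le> v \<and> v \<le> m) \<or> (v = 0 \<and> 1 \<le> u \<and> u \<le> m)"
  by (auto simp: star_def doubleton_eq_iff)

text \<open>One of any two consecutive vertices is the centre 0, so a path on four vertices would
  visit 0 twice.\<close>

lemma path_star_cases:
  assumes "path V (star m) p"
  obtains a where "p = [a]" | a b where "p = [a, b]"
    | a b where "p = [a, 0, b]" "a \<noteq> b" "a \<in> {1..m}" "b \<in> {1..m}"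
proof -
  consider "p = []" | a where "p = [a]" | a b where "p = [a, b]" | a b c where "p = [a, b, c]"
    | a b c d q where "p = a # b # c # d # q"
    by (metis list.exhaust)
  then show thesis
    using assms that by cases (auto simp: path_def star_edge_iff)
qed

lemma tree_star: "tree {0..m} (star m)"
proof -
  have "\<exists>p. path {0..m} (star m) p \<and> hd p = u \<and> last p = v" if "u \<le> m" "v \<le> m" for u v
  proof (cases "u = v")
    case True
    then show ?thesis
      using that by (intro exI[of _ "[u]"]) (auto simp: path_def)
  next
    case False
    then show ?thesis
      using that
      by (intro exI[of _ "if u = 0 \<or> v = 0 then [u, v] else [u, 0, v]"])
        (auto simp: path_def star_edge_iff)
  qed
  moreover have "\<not> cycle {0..m} (star m) c" for c
    by (auto simp: cycle_def star_edge_iff elim!: path_star_cases)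
  ultimately show ?thesis
    by (auto simp: tree_def simple_graph_def star_def)
qed

text \<open>Between two leaves a path passes only the centre, so the separation condition amounts to
  the common part of two leaf bags lying in the central bag.\<close>

lemma tree_decomposition_star:
  assumes "\<And>t. t \<le> m \<Longrightarrow> \<chi> t \<subseteq> V"
    and "\<And>v. v \<in> V \<Longrightarrow> \<exists>t\<le>m. v \<in> \<chi> t"
    and "\<And>u v. {u, v} \<in> E \<Longrightarrow> \<exists>t\<le>m. u \<in> \<chi> t \<and> v \<in> \<chi> t"
    and "\<And>s t. s \<in> {1..m} \<Longrightarrow> t \<in> {1..m} \<Longrightarrow> s \<noteq> t \<Longrightarrow> \<chi> s \<inter> \<chi> t \<subseteq> \<chi> 0"
  shows "tree_decomposition V E {0..m} (star m) \<chi>"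
proof -
  have "(\<chi> (hd p) - \<chi> t) \<inter> (\<chi> (last p) - \<chi> t) = {}" if "path {0..m} (star m) p" "t \<in> set p" for p t
    using that(1)
  proof (cases rule: path_star_cases)
    case (3 a b)
    then show ?thesis
      using that(2) assms(4)[of a b] by auto
  qed (use that(2) in auto)
  then show ?thesis
    using assms(1-3) tree_star[of m] unfolding tree_decomposition_def
    by (simp add: Bex_def)
qed

text \<open>If a bag \<open>\<chi> t\<close> misses \<open>v \<in> K\<close>, walk from \<open>t\<close> to the nearest bag containing \<open>v\<close>.  For every
  \<open>u \<in> K\<close> in \<open>\<chi> t\<close> the walk extends to a path ending in a bag with both \<open>u\<close> and \<open>v\<close>, so the nearest
  bag contains \<open>u\<close>, and hence more of \<open>K\<close> than \<open>\<chi> t\<close>.\<close>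

lemma clique_in_bag:
  assumes td: "tree_decomposition V E T F \<chi>" and K: "K \<subseteq> V" "finite K"
    and edges: "\<And>u v. u \<in> K \<Longrightarrow> v \<in> K \<Longrightarrow> u \<noteq> v \<Longrightarrow> {u, v} \<in> E"
  shows "\<exists>t\<in>T. K \<subseteq> \<chi> t"
proof -
  have T: "finite T" "T \<noteq> {}"
    and conn: "\<And>s t. s \<in> T \<Longrightarrow> t \<in> T \<Longrightarrow> \<exists>p. path T F p \<and> hd p = s \<and> last p = t"
    and cover: "\<And>v. v \<in> V \<Longrightarrow> \<exists>t\<in>T. v \<in> \<chi> t"
    and ecover: "\<And>u v. {u, v} \<in> E \<Longrightarrow> \<exists>t\<in>T. u \<in> \<chi> t \<and> v \<in> \<chi> t"
    and between: "\<And>p t v. path T F p \<Longrightarrow> t \<in> set p \<Longrightarrow> v \<in> \<chi> (hd p) \<Longrightarrow> v \<in> \<chi> (last p) \<Longrightarrow> v \<in> \<chi> t"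
    using td unfolding tree_decomposition_def tree_def simple_graph_def by blast+
  let ?f = "\<lambda>t. card (\<chi> t \<inter> K)"
  obtain t where t: "t \<in> T" and tmax: "\<And>s. s \<in> T \<Longrightarrow> ?f s \<le> ?f t"
  proof -
    have "Max (?f ` T) \<in> ?f ` T"
      using T by (intro Max_in) auto
    then obtain t where "t \<in> T" "?f t = Max (?f ` T)"
      by auto
    then show thesis
      using that[of t] T by simp
  qed
  have "K \<subseteq> \<chi> t"
  proof (rule ccontr)
    assume "\<not> K \<subseteq> \<chi> t"
    then obtain v where v: "v \<in> K" "v \<notin> \<chi> t"
      by blast
    let ?P = "\<lambda>p. path T F p \<and> hd p = t \<and> v \<in> \<chi> (last p)"
    have "\<exists>p. ?P p"
      using cover[of v] conn[OF t] v K by blast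
    then obtain p where p: "?P p" and pmin: "\<And>q. ?P q \<Longrightarrow> length p \<le> length q"
      using ex_has_least_nat[of ?P _ length] by blast
    define s where "s = last p"
    define p0 where "p0 = butlast p"
    have pne: "p \<noteq> []"
      using p by (simp add: path_def)
    then have p_eq: "p = p0 @ [s]"
      by (simp add: s_def p0_def)
    have sT: "s \<in> T"
      using p p_eq by (auto simp: path_def)
    have p0ne: "p0 \<noteq> []"
      using p p_eq v by (cases p0) auto
    have nearest: "v \<notin> \<chi> x" if x: "x \<in> set p0" for x
    proof
      assume "v \<in> \<chi> x"
      obtain a b where ab: "p0 = a @ x # b"
        using split_list[OF x] by blast
      have "successively (\<lambda>u v. {u, v} \<in> F) ((a @ [x]) @ (b @ [s]))"
        using p by (simp add: p_eq ab path_def)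
      then have "successively (\<lambda>u v. {u, v} \<in> F) (a @ [x])"
        by (simp only: successively_append_iff)
      then have "?P (a @ [x])"
        using p \<open>v \<in> \<chi> x\<close> unfolding p_eq ab path_def by (cases a) auto
      from pmin[OF this] show False
        unfolding p_eq ab by simp
    qed
    have "\<chi> t \<inter> K \<subseteq> \<chi> s"
    proof
      fix u assume u: "u \<in> \<chi> t \<inter> K"
      then have "{u, v} \<in> E"
        using edges v by blast
      then obtain s' where s': "s' \<in> T" "u \<in> \<chi> s'" "v \<in> \<chi> s'"
        using ecover by blast
      obtain q where q: "path T F q" "hd q = s" "last q = s'"
        using conn[OF sT s'(1)] by blast
      have qv: "v \<in> \<chi> x" if "x \<in> set q" for x
        using between[OF q(1) that] q p s' s_def by simp
      obtain q' where q': "q = s # q'"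
        using q by (cases q) (auto simp: path_def)
      have "path T F (p0 @ q)"
        using p q(1) nearest qv unfolding p_eq q' path_def
        by (auto simp: successively_append_iff)
      moreover have "hd (p0 @ q) = t" "last (p0 @ q) = s'"
        using p p0ne q q' p_eq by auto
      ultimately show "u \<in> \<chi> s"
        using between[of "p0 @ q" s u] u s' q' by auto
    qed
    moreover have "v \<in> \<chi> s"
      using p s_def by simp
    ultimately have "insert v (\<chi> t \<inter> K) \<subseteq> \<chi> s \<inter> K"
      using v by blast
    then have "card (insert v (\<chi> t \<inter> K)) \<le> ?f s"
      using K by (intro card_mono) auto
    then show False
      using tmax[OF sT] v K by simp
  qed
  then show ?thesis
    using t by blast
qed

text \<open>The given decomposition yields the upper bound; the bag that contains \<open>K\<close>
  in an arbitrary decomposition yields the lower one.\<close>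

lemma treewidth_eqI:
  fixes T :: "nat set"
  assumes td: "tree_decomposition V E T F \<chi>" and "finite V"
    and K: "K \<subseteq> V" "\<And>u v. u \<in> K \<Longrightarrow> v \<in> K \<Longrightarrow> u \<noteq> v \<Longrightarrow> {u, v} \<in> E"
    and width: "width T \<chi> = card K - 1"
  shows "treewidth V E = card K - 1"
  unfolding treewidth_def
proof (rule Least_equality)
  show "\<exists>(T :: nat set) F \<chi>. tree_decomposition V E T F \<chi> \<and> width T \<chi> = card K - 1"
    using td width by blast
next
  fix k assume "\<exists>(T :: nat set) F \<chi>. tree_decomposition V E T F \<chi> \<and> width T \<chi> = k"
  then obtain T :: "nat set" and F \<chi> where td': "tree_decomposition V E T F \<chi>" "width T \<chi> = k"
    by blast
  have "finite K"
    using K(1) \<open>finite V\<close> finite_subset by blast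
  then obtain t where t: "t \<in> T" "K \<subseteq> \<chi> t"
    using clique_in_bag[OF td'(1) K(1) _ K(2)] by blast
  have "\<chi> t \<subseteq> V" "finite T"
    using td'(1) t(1) by (auto simp: tree_decomposition_def tree_def simple_graph_def)
  then have "card K \<le> card (\<chi> t)"
    using t(2) \<open>finite V\<close> by (intro card_mono) (auto intro: finite_subset)
  also have "\<dots> \<le> Max ((\<lambda>t. card (\<chi> t)) ` T)"
    using t(1) \<open>finite T\<close> by (intro Max_ge) auto
  finally show "card K - 1 \<le> k"
    using td'(2) by (simp add: width_def)
qed

section \<open>Orientations of graphs given by symmetric weight functions\<close>

definition edges_of :: "nat \<Rightarrow> (nat \<Rightarrow> nat \<Rightarrow> nat) \<Rightarrow> nat set set" where
  "edges_of N W = {{u, v} | u v. u < N \<and> v < N \<and> 0 < W u v}"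

text \<open>\<open>Min\<close> and \<open>Max\<close> list the two ends of an edge in a canonical
  order, so a weight on ordered pairs becomes a weight on edges.\<close>

definition weight_of :: "(nat \<Rightarrow> nat \<Rightarrow> nat) \<Rightarrow> nat set \<Rightarrow> nat" where
  "weight_of W e = W (Min e) (Max e)"

definition symmetric_weights :: "(nat \<Rightarrow> nat \<Rightarrow> nat) \<Rightarrow> bool" where
  "symmetric_weights W \<longleftrightarrow> (\<forall>u v. W u v = W v u) \<and> (\<forall>u. W u u = 0)"

text \<open>\<open>D u v\<close> says that the edge \<open>uv\<close> is directed from \<open>u\<close> to \<open>v\<close>.\<close>

definition orientable :: "nat \<Rightarrow> (nat \<Rightarrow> nat \<Rightarrow> nat) \<Rightarrow> nat \<Rightarrow> bool" where
  "orientable N W r \<longleftrightarrow> (\<exists>D. (\<forall>u<N. \<forall>v<N. 0 < W u v \<longrightarrow> D u v = (\<not> D v u)) \<and>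
     (\<forall>u<N. (\<Sum>v<N. if D u v then W u v else 0) \<le> r))"

lemma edges_of_iff:
  assumes "symmetric_weights W"
  shows "{u, v} \<in> edges_of N W \<longleftrightarrow> u < N \<and> v < N \<and> 0 < W u v"
proof
  assume "{u, v} \<in> edges_of N W"
  then obtain u' v' where "{u, v} = {u', v'}" "u' < N" "v' < N" "0 < W u' v'"
    by (auto simp: edges_of_def)
  then show "u < N \<and> v < N \<and> 0 < W u v"
    using assms by (auto simp: doubleton_eq_iff symmetric_weights_def)
qed (auto simp: edges_of_def)

lemma weight_of_edge: "symmetric_weights W \<Longrightarrow> weight_of W {u, v} = W u v"
  by (cases u v rule: linorder_cases)
    (auto simp: weight_of_def symmetric_weights_def min_def max_def)

lemma simple_graph_edges_of:
  assumes "symmetric_weights W"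
  shows "simple_graph {0..<N} (edges_of N W)"
proof -
  have "card {u, v} = 2" if "0 < W u v" for u v
    using that assms by (cases "u = v") (auto simp: symmetric_weights_def)
  then show ?thesis
    by (auto simp: simple_graph_def edges_of_def)
qed

lemma edge_weighting_edges_of:
  "symmetric_weights W \<Longrightarrow> edge_weighting (edges_of N W) (weight_of W)"
  by (auto simp: edge_weighting_def edges_of_def weight_of_edge)

lemma weighted_outdegree_edges_of:
  assumes "symmetric_weights W" "v < N"
  shows "weighted_outdegree (edges_of N W) (weight_of W) \<Lambda> v =
    (\<Sum>u<N. if \<Lambda> {v, u} = (v, u) then W v u else 0)"
proof -
  have "weighted_outdegree (edges_of N W) (weight_of W) \<Lambda> v =
      (\<Sum>u | u < N \<and> 0 < W v u \<and> \<Lambda> {v, u} = (v, u). W v u)"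
    unfolding weighted_outdegree_def using assms
    by (intro sum.cong) (auto simp: edges_of_iff weight_of_edge)
  also have "\<dots> = (\<Sum>u | u \<in> {..<N} \<and> \<Lambda> {v, u} = (v, u). W v u)"
    by (rule sum.mono_neutral_left) auto
  also have "\<dots> = (\<Sum>u<N. if \<Lambda> {v, u} = (v, u) then W v u else 0)"
    by (rule sum.inter_filter) simp
  finally show ?thesis .
qed

lemma orientable_iff:
  assumes W: "symmetric_weights W"
  shows "(\<exists>\<Lambda>. orientation (edges_of N W) \<Lambda> \<and>
           (\<forall>v\<in>{0..<N}. weighted_outdegree (edges_of N W) (weight_of W) \<Lambda> v \<le> r)) \<longleftrightarrow> orientable N W r"
    (is "?L \<longleftrightarrow> ?R")
proof
  assume ?L
  then obtain \<Lambda> where \<Lambda>: "orientation (edges_of N W) \<Lambda>"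
      "\<And>v. v < N \<Longrightarrow> (\<Sum>u<N. if \<Lambda> {v, u} = (v, u) then W v u else 0) \<le> r"
    using weighted_outdegree_edges_of[OF W] by auto
  have "(\<Lambda> {u, v} = (u, v)) = (\<Lambda> {v, u} \<noteq> (v, u))" if "u < N" "v < N" "0 < W u v" for u v
  proof -
    have "\<Lambda> {u, v} \<in> {(u, v), (v, u)}" "u \<noteq> v"
      using that \<Lambda>(1) W edges_of_iff[OF W, of u v N]
      by (auto simp: orientation_def symmetric_weights_def)
    then show ?thesis
      by (auto simp: insert_commute)
  qed
  then show ?R
    unfolding orientable_def using \<Lambda>(2)
    by (intro exI[of _ "\<lambda>u v. \<Lambda> {u, v} = (u, v)"]) simp
next
  assume ?R
  then obtain D where D: "\<And>u v. u < N \<Longrightarrow> v < N \<Longrightarrow> 0 < W u v \<Longrightarrow> D u v = (\<not> D v u)"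
      "\<And>u. u < N \<Longrightarrow> (\<Sum>v<N. if D u v then W u v else 0) \<le> r"
    unfolding orientable_def by blast
  define \<Lambda> where "\<Lambda> e = (if D (Min e) (Max e) then (Min e, Max e) else (Max e, Min e))" for e :: "nat set"
  have *: "\<Lambda> {u, v} = (u, v) \<longleftrightarrow> D u v" if "u < N" "v < N" "0 < W u v" for u v
  proof -
    have "u \<noteq> v"
      using that W by (auto simp: symmetric_weights_def)
    then show ?thesis
      using D(1)[OF that] by (auto simp: \<Lambda>_def min_def max_def)
  qed
  have "(\<Sum>v<N. if \<Lambda> {u, v} = (u, v) then W u v else 0) = (\<Sum>v<N. if D u v then W u v else 0)"
    if "u < N" for u
    using that * by (intro sum.cong) auto
  moreover have "orientation (edges_of N W) \<Lambda>"
    by (auto simp: orientation_def \<Lambda>_def min_def max_def)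
  ultimately show ?L
    using D(2) weighted_outdegree_edges_of[OF W] by (intro exI[of _ \<Lambda>]) auto
qed


text \<open>Vertices below \<open>H\<close> are hubs, \<open>H + 2 * t\<close> and \<open>H + 2 * t + 1\<close> are the two sides of item \<open>t\<close>, and
  the remaining \<open>H + 2\<close> vertices form a clique, which fixes the treewidth.  The weight from side
  \<open>d\<close> of item \<open>t\<close> to hub \<open>h\<close> is \<open>c t d h\<close>.\<close>

definition arc_weight ::
    "nat \<Rightarrow> nat \<Rightarrow> nat \<Rightarrow> (nat \<Rightarrow> nat \<Rightarrow> nat \<Rightarrow> nat) \<Rightarrow> nat \<Rightarrow> nat \<Rightarrow> nat" where
  "arc_weight H T r c u v =
    (if v < H then 0
     else if v < H + 2 * T then
       (if u < H then c ((v - H) div 2) ((v - H) mod 2) u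
        else if (u - H) div 2 = (v - H) div 2 then r else 0)
     else if u < H + 2 * T then 0 else 1)"

definition gadget_weight ::
    "nat \<Rightarrow> nat \<Rightarrow> nat \<Rightarrow> (nat \<Rightarrow> nat \<Rightarrow> nat \<Rightarrow> nat) \<Rightarrow> nat \<Rightarrow> nat \<Rightarrow> nat" where
  "gadget_weight H T r c u v =
    (if u < v then arc_weight H T r c u v else if v < u then arc_weight H T r c v u else 0)"

lemma symmetric_gadget_weight: "symmetric_weights (gadget_weight H T r c)"
  by (auto simp: symmetric_weights_def gadget_weight_def)

lemma sum_vertices:
  fixes f :: "nat \<Rightarrow> nat"
  shows "(\<Sum>v<H + 2 * T + Q. f v) =
    (\<Sum>v<H. f v) + (\<Sum>t<T. f (H + 2 * t) + f (H + 2 * t + 1)) + (\<Sum>q<Q. f (H + 2 * T + q))"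
proof (induction Q)
  case 0
  show ?case
    by (induction T) (simp_all add: add_ac)
qed simp

lemma vertex_cases:
  fixes u :: nat
  assumes "u < H + 2 * T + Q"
  obtains "u < H" | t d where "t < T" "d < 2" "u = H + 2 * t + d" | q where "q < Q" "u = H + 2 * T + q"
proof -
  consider "u < H" | "H \<le> u" "u < H + 2 * T" | "H + 2 * T \<le> u"
    by linarith
  then show thesis
  proof cases
    case 2
    show thesis
      by (rule that(2)[of "(u - H) div 2" "(u - H) mod 2"]) (use 2 in auto)
  next
    case 3
    show thesis
      by (rule that(3)[of "u - (H + 2 * T)"]) (use 3 assms in auto)
  qed (use that in blast)
qed

lemma gadget_weight_simps:
  assumes "t < T" "d < 2"
  shows "h < H \<Longrightarrow> gadget_weight H T r c h (H + 2 * t + d) = c t d h"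
    and "h < H \<Longrightarrow> gadget_weight H T r c (H + 2 * t + d) h = c t d h"
    and "t' < T \<Longrightarrow> d' < 2 \<Longrightarrow> gadget_weight H T r c (H + 2 * t + d) (H + 2 * t' + d') =
      (if t = t' \<and> d \<noteq> d' then r else 0)"
    and "gadget_weight H T r c (H + 2 * t + d) (H + 2 * T + q) = 0"
    and "gadget_weight H T r c (H + 2 * T + q) (H + 2 * t + d) = 0"
proof -
  have d: "(H + 2 * t + d - H) div 2 = t" "(H + 2 * t + d - H) mod 2 = d" if "d < 2" for t d
    using that by auto
  show "h < H \<Longrightarrow> gadget_weight H T r c h (H + 2 * t + d) = c t d h"
    "h < H \<Longrightarrow> gadget_weight H T r c (H + 2 * t + d) h = c t d h"
    unfolding gadget_weight_def arc_weight_def d[OF assms(2)] using assms by auto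
  show "gadget_weight H T r c (H + 2 * t + d) (H + 2 * T + q) = 0"
    "gadget_weight H T r c (H + 2 * T + q) (H + 2 * t + d) = 0"
    unfolding gadget_weight_def arc_weight_def d[OF assms(2)] using assms by auto
  show "gadget_weight H T r c (H + 2 * t + d) (H + 2 * t' + d') =
      (if t = t' \<and> d \<noteq> d' then r else 0)" if "t' < T" "d' < 2"
    unfolding gadget_weight_def arc_weight_def d[OF assms(2)] d[OF that(2)] using assms that by auto
qed

lemma gadget_weight_hubs: "h < H \<Longrightarrow> h' < H \<Longrightarrow> gadget_weight H T r c h h' = 0"
  by (simp add: gadget_weight_def arc_weight_def)

lemma gadget_weight_clique:
  "h < H \<Longrightarrow> gadget_weight H T r c h (H + 2 * T + q) = 0"
  "h < H \<Longrightarrow> gadget_weight H T r c (H + 2 * T + q) h = 0"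
  "gadget_weight H T r c (H + 2 * T + q) (H + 2 * T + q') = (if q = q' then 0 else 1)"
  by (simp_all add: gadget_weight_def arc_weight_def)

text \<open>Let \<open>s t\<close> be the side that carries the edge of item \<open>t\<close>. It is
  full, so the hubs carry its hub edges, and their loads are the sums in question. Conversely, the
  other side pays for its own hub edges, whence the condition on \<open>c\<close>, and the clique is
  oriented by increasing index.\<close>

lemma gadget_orientable_iff:
  assumes "0 < r"
    and clique_size: "H + 1 \<le> r"
  shows "orientable (H + 2 * T + (H + 2)) (gadget_weight H T r c) r \<Longrightarrow>
      \<exists>s. (\<forall>t. s t < 2) \<and> (\<forall>h<H. (\<Sum>t<T. c t (s t) h) \<le> r)"
    and "(\<And>t d. t < T \<Longrightarrow> d < 2 \<Longrightarrow> (\<Sum>h<H. c t d h) \<le> r) \<Longrightarrow>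
      \<exists>s. (\<forall>t. s t < 2) \<and> (\<forall>h<H. (\<Sum>t<T. c t (s t) h) \<le> r) \<Longrightarrow>
      orientable (H + 2 * T + (H + 2)) (gadget_weight H T r c) r"
proof -
  let ?W = "gadget_weight H T r c" and ?N = "H + 2 * T + (H + 2)"
  {
    assume "orientable ?N ?W r"
    then obtain D where D: "\<And>u v. u < ?N \<Longrightarrow> v < ?N \<Longrightarrow> 0 < ?W u v \<Longrightarrow> D u v = (\<not> D v u)"
      and load: "\<And>u. u < ?N \<Longrightarrow> (\<Sum>v<?N. if D u v then ?W u v else 0) \<le> r"
      unfolding orientable_def by blast
    \<comment> \<open>The side from which the edge of item \<open>t\<close> is directed.\<close>
    define s :: "nat \<Rightarrow> nat" where "s t = (if D (H + 2 * t) (H + 2 * t + 1) then 0 else 1)" for t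
    have s: "s t < 2" for t
      by (simp add: s_def)
    have sends: "D h (H + 2 * t + s t)" if t: "t < T" "h < H" "0 < c t (s t) h" for t h
    proof -
      let ?z = "H + 2 * t + s t" and ?z' = "H + 2 * t + (1 - s t)"
      have z: "?z < ?N" "?z' < ?N" "h < ?N" "?z' \<noteq> h"
        using t s[of t] by auto
      have W: "?W ?z h = c t (s t) h" "?W ?z ?z' = r"
        using gadget_weight_simps(2)[OF t(1) s t(2)] gadget_weight_simps(3)[OF t(1) s[of t] t(1), of "1 - s t"]
        by (auto simp: s_def)
      have "D ?z ?z'"
        using D[OF z(1,2)] W \<open>0 < r\<close> D[OF z(2,1)] by (auto simp: s_def split: if_splits)
      \<comment> \<open>The item edge alone has weight \<open>r\<close>; any further edge of
        positive weight directed away from \<open>?z\<close> would exceed the capacity.\<close>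
      have "\<not> D ?z h"
      proof
        assume "D ?z h"
        have "(\<Sum>v\<in>{h, ?z'}. if D ?z v then ?W ?z v else 0) \<le> (\<Sum>v<?N. if D ?z v then ?W ?z v else 0)"
          using z by (intro sum_mono2) auto
        then show False
          using load[OF z(1)] W t(3) \<open>D ?z h\<close> \<open>D ?z ?z'\<close> z(4) by simp
      qed
      then show ?thesis
        using D[OF z(1,3)] W t(3) by simp
    qed
    have "(\<Sum>t<T. c t (s t) h) \<le> r" if h: "h < H" for h
    proof -
      let ?f = "\<lambda>v. if D h v then ?W h v else 0"
      have "c t (s t) h \<le> ?f (H + 2 * t) + ?f (H + 2 * t + 1)" if "t < T" for t
      proof -
        have "c t (s t) h \<le> ?f (H + 2 * t + s t)"
          using sends[OF that h] gadget_weight_simps(1)[OF that s h] by (cases "c t (s t) h = 0") auto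
        then show ?thesis
          by (cases "s t = 0") (use s[of t] in \<open>auto simp: less_2_cases_iff\<close>)
      qed
      then have "(\<Sum>t<T. c t (s t) h) \<le> (\<Sum>t<T. ?f (H + 2 * t) + ?f (H + 2 * t + 1))"
        by (intro sum_mono) auto
      also have "\<dots> \<le> (\<Sum>v<?N. ?f v)"
        unfolding sum_vertices by simp
      also have "\<dots> \<le> r"
        using load[of h] h by simp
      finally show ?thesis .
    qed
    then show "\<exists>s. (\<forall>t. s t < 2) \<and> (\<forall>h<H. (\<Sum>t<T. c t (s t) h) \<le> r)"
      using s by blast
  }
  {
    assume c: "\<And>t d. t < T \<Longrightarrow> d < 2 \<Longrightarrow> (\<Sum>h<H. c t d h) \<le> r"
      and "\<exists>s. (\<forall>t. s t < 2) \<and> (\<forall>h<H. (\<Sum>t<T. c t (s t) h) \<le> r)"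
    then obtain s :: "nat \<Rightarrow> nat" where s: "\<And>t. s t < 2"
      and hub: "\<And>h. h < H \<Longrightarrow> (\<Sum>t<T. c t (s t) h) \<le> r"
      by blast
    \<comment> \<open>Read off \<open>s\<close> at items and hubs, and off the order of indices in
      the clique. The values at non-edges are immaterial, as their weight is 0.\<close>
    define D where "D u v \<longleftrightarrow>
      (if u < H then s ((v - H) div 2) = (v - H) mod 2
       else if v < H then s ((u - H) div 2) \<noteq> (u - H) mod 2
       else if u < H + 2 * T then s ((u - H) div 2) = (u - H) mod 2
       else u < v)" for u v
    have dec: "(H + 2 * t + d - H) div 2 = t" "(H + 2 * t + d - H) mod 2 = d" if "d < 2" for t d
      using that by auto
    have D1: "D h (H + 2 * t + d) \<longleftrightarrow> s t = d" "D (H + 2 * t + d) h \<longleftrightarrow> s t \<noteq> d" if "h < H" "d < 2" for h t d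
      unfolding D_def dec[OF that(2)] using that by auto
    have D2: "D (H + 2 * t + d) (H + v) \<longleftrightarrow> s t = d" if "t < T" "d < 2" for t d v
      unfolding D_def dec[OF that(2)] using that by auto
    have D3: "D (H + 2 * T + q) (H + 2 * T + q') \<longleftrightarrow> q < q'" for q q'
      by (simp add: D_def)
    have "D u v = (\<not> D v u)" if "u < ?N" "v < ?N" "0 < ?W u v" for u v
      using that(1)
    proof (cases rule: vertex_cases)
      case 1
      show ?thesis
        using that(2)
        by (cases rule: vertex_cases)
          (use 1 that(3) in \<open>auto simp: D1 gadget_weight_hubs gadget_weight_clique\<close>)
    next
      case u: (2 t d)
      show ?thesis
        using that(2)
      proof (cases rule: vertex_cases)
        case v: (2 t' d')
        have "t = t'" "d \<noteq> d'"
          using that(3) u v gadget_weight_simps(3)[OF u(1,2) v(1,2), of H r c] by (auto split: if_splits)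
        then show ?thesis
          using D2[OF u(1,2), of "2 * t' + d'"] D2[OF v(1,2), of "2 * t + d"] u v s[of t]
          by (auto simp: add.assoc less_2_cases_iff)
      qed (use u that(3) in \<open>auto simp: D1 gadget_weight_simps\<close>)
    next
      case u: (3 q)
      show ?thesis
        using that(2)
        by (cases rule: vertex_cases)
          (use u that(3) in \<open>auto simp: D1 D3 gadget_weight_clique gadget_weight_simps split: if_splits\<close>)
    qed
    moreover have "(\<Sum>v<?N. if D u v then ?W u v else 0) \<le> r" if "u < ?N" for u
      using that
    proof (cases rule: vertex_cases)
      case 1
      have "(\<Sum>v<?N. if D u v then ?W u v else 0) =
          (\<Sum>t<T. (if s t = 0 then c t 0 u else 0) + (if s t = 1 then c t 1 u else 0))"
        unfolding sum_vertices using 1 D1[OF 1, of 0] D1[OF 1, of 1]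
          gadget_weight_simps(1)[where d = 0 and h = u] gadget_weight_simps(1)[where d = 1 and h = u]
        by (simp add: gadget_weight_hubs gadget_weight_clique cong: if_cong)
      also have "\<dots> = (\<Sum>t<T. c t (s t) u)"
      proof (rule sum.cong)
        fix t show "(if s t = 0 then c t 0 u else 0) + (if s t = 1 then c t 1 u else 0) = c t (s t) u"
          using s[of t] by (auto simp: less_2_cases_iff)
      qed simp
      finally show ?thesis
        using hub[OF 1] by simp
    next
      case u: (2 t d)
      show ?thesis
      proof (cases "s t = d")
        case True
        have "(\<Sum>v<?N. if D u v then ?W u v else 0) \<le> (\<Sum>v<?N. if v = H + 2 * t + (1 - d) then r else 0)"
        proof (rule sum_mono)
          fix v assume "v \<in> {..<?N}"
          then have "v < ?N" by simp
          then show "(if D u v then ?W u v else 0) \<le> (if v = H + 2 * t + (1 - d) then r else 0)"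
          proof (cases rule: vertex_cases)
            case v: (2 t' d')
            then show ?thesis
              using u by (auto simp: gadget_weight_simps less_2_cases_iff)
          qed (use u True in \<open>auto simp: D1 gadget_weight_simps\<close>)
        qed
        also have "\<dots> \<le> r"
          by simp
        finally show ?thesis .
      next
        case False
        have D2': "\<not> D u v" if "H \<le> v" for v
          using D2[OF u(1,2), of "v - H"] False u that by simp
        have "(\<Sum>v<?N. if D u v then ?W u v else 0) \<le> (\<Sum>v<?N. if v < H then c t d v else 0)"
        proof (rule sum_mono)
          fix v assume "v \<in> {..<?N}"
          then have "v < ?N" by simp
          then show "(if D u v then ?W u v else 0) \<le> (if v < H then c t d v else 0)"
            by (cases rule: vertex_cases) (use u False D2' in \<open>auto simp: gadget_weight_simps\<close>)
        qed
        also have "\<dots> = (\<Sum>h<H. c t d h)"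
          unfolding sum_vertices by simp
        finally show ?thesis
          using c[OF u(1,2)] by simp
      qed
    next
      case u: (3 q)
      \<comment> \<open>A clique vertex carries unit weights towards larger indices only, hence at
        most the \<open>H + 1\<close> edges to the other clique vertices.\<close>
      have "(\<Sum>v<?N. if D u v then ?W u v else 0) \<le> (\<Sum>v<?N. if H + 2 * T + q < v then 1 else 0)"
      proof (rule sum_mono)
        fix v assume "v \<in> {..<?N}"
        then have "v < ?N" by simp
        then show "(if D u v then ?W u v else 0) \<le> (if H + 2 * T + q < v then 1 else 0)"
          by (cases rule: vertex_cases)
            (use u in \<open>auto simp: D3 gadget_weight_simps gadget_weight_clique\<close>)
      qed
      also have "\<dots> = (\<Sum>v | v \<in> {..<?N} \<and> H + 2 * T + q < v. 1)"
        by (rule sum.inter_filter[symmetric]) simp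
      also have "\<dots> \<le> card {H + 2 * T + 1..<?N}"
        unfolding card_eq_sum by (intro sum_mono2) auto
      also have "\<dots> \<le> r"
        using clique_size by simp
      finally show ?thesis .
    qed
    ultimately show "orientable ?N ?W r"
      unfolding orientable_def by blast
  }
qed

text \<open>An item leaf holds all hubs and the two sides of the item, at most \<open>H + 2\<close>
  vertices in total. The separate clique has exactly that many and fills one more leaf, so the value
  is the same for all weights \<open>c\<close>.\<close>

lemma gadget_treewidth:
  "treewidth {0..<H + 2 * T + (H + 2)} (edges_of (H + 2 * T + (H + 2)) (gadget_weight H T r c)) = H + 1"
proof -
  let ?W = "gadget_weight H T r c" and ?N = "H + 2 * T + (H + 2)"
  let ?K = "{H + 2 * T..<?N}"
  define \<chi> where "\<chi> t = (if t = 0 then {..<H} else if t \<le> T then {..<H} \<union> {H + 2 * (t - 1), H + 2 * (t - 1) + 1}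
    else ?K)" for t
  have item: "H + 2 * t + d \<in> \<chi> (t + 1)" "h < H \<Longrightarrow> h \<in> \<chi> (t + 1)" if "t < T" "d < 2" for t d h
    using that by (auto simp: \<chi>_def less_2_cases_iff)
  have "tree_decomposition {0..<?N} (edges_of ?N ?W) {0..T + 1} (star (T + 1)) \<chi>"
  proof (rule tree_decomposition_star)
    fix t assume "t \<le> T + 1"
    then show "\<chi> t \<subseteq> {0..<?N}"
      by (auto simp: \<chi>_def)
  next
    fix v assume "v \<in> {0..<?N}"
    then have "v < ?N" by simp
    then show "\<exists>t\<le>T + 1. v \<in> \<chi> t"
    proof (cases rule: vertex_cases)
      case 1
      then show ?thesis
        by (intro exI[of _ 0]) (simp add: \<chi>_def)
    next
      case (2 t d)
      then show ?thesis
        using item(1)[OF 2(1,2)] by (intro exI[of _ "t + 1"]) simp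
    next
      case (3 q)
      then show ?thesis
        by (intro exI[of _ "T + 1"]) (simp add: \<chi>_def)
    qed
  next
    fix u v assume "{u, v} \<in> edges_of ?N ?W"
    then have uv: "u < ?N" "v < ?N" "0 < ?W u v"
      using edges_of_iff[OF symmetric_gadget_weight] by auto
    from uv(1) show "\<exists>t\<le>T + 1. u \<in> \<chi> t \<and> v \<in> \<chi> t"
    proof (cases rule: vertex_cases)
      case u: 1
      from uv(2) show ?thesis
      proof (cases rule: vertex_cases)
        case (2 t d)
        then show ?thesis
          using item[OF 2(1,2)] u by (intro exI[of _ "t + 1"]) simp
      qed (use u uv(3) in \<open>auto simp: gadget_weight_hubs gadget_weight_clique\<close>)
    next
      case u: (2 t d)
      from uv(2) show ?thesis
      proof (cases rule: vertex_cases)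
        case 1
        then show ?thesis
          using item[OF u(1,2)] u by (intro exI[of _ "t + 1"]) simp
      next
        case (2 t' d')
        then have "t = t'"
          using u uv(3) by (auto simp: gadget_weight_simps split: if_splits)
        then show ?thesis
          using item[OF u(1,2)] item[OF 2(1,2)] u 2 by (intro exI[of _ "t + 1"]) simp
      qed (use u uv(3) in \<open>auto simp: gadget_weight_simps\<close>)
    next
      case u: (3 q)
      from uv(2) show ?thesis
      proof (cases rule: vertex_cases)
        case (3 q')
        then show ?thesis
          using u by (intro exI[of _ "T + 1"]) (simp add: \<chi>_def)
      qed (use u uv(3) in \<open>auto simp: gadget_weight_simps gadget_weight_clique\<close>)
    qed
  next
    fix s t assume "s \<in> {1..T + 1}" "t \<in> {1..T + 1}" "s \<noteq> t"
    then show "\<chi> s \<inter> \<chi> t \<subseteq> \<chi> 0"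
      by (auto simp: \<chi>_def)
  qed
  moreover have "width {0..T + 1} \<chi> = card ?K - 1"
  proof -
    have "card (\<chi> t) \<le> H + 2" for t
    proof -
      have "card ({..<H} \<union> {H + 2 * (t - 1), H + 2 * (t - 1) + 1}) \<le> H + 2"
        using card_Un_le[of "{..<H}" "{H + 2 * (t - 1), H + 2 * (t - 1) + 1}"] by simp
      then show ?thesis
        by (simp add: \<chi>_def)
    qed
    moreover have "card (\<chi> (T + 1)) = H + 2"
      by (simp add: \<chi>_def)
    ultimately have "Max ((\<lambda>t. card (\<chi> t)) ` {0..T + 1}) = H + 2"
      by (intro Max_eqI) (auto intro!: image_eqI[of _ _ "T + 1"])
    then show ?thesis
      by (simp add: width_def)
  qed
  moreover have "{u, v} \<in> edges_of ?N ?W" if "u \<in> ?K" "v \<in> ?K" "u \<noteq> v" for u v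
    using that edges_of_iff[OF symmetric_gadget_weight]
    by (auto simp: gadget_weight_def arc_weight_def)
  ultimately have "treewidth {0..<?N} (edges_of ?N ?W) = card ?K - 1"
    by (intro treewidth_eqI) auto
  then show ?thesis
    by simp
qed

subsection \<open>From cliques to hub loads\<close>

text \<open>Item \<open>t = (i * k + j) * n\<^sup>2 + a * n + b\<close> stands for choosing the vertices \<open>a\<close> and \<open>b\<close> as members
  number \<open>i\<close> and \<open>j\<close> of the clique; side 0 is the loaded one iff the choice is made.  The hubs
  \<open>(e, i', j', l)\<close> bound the load by \<open>L = n\<^sup>2 - 1\<close>.  For \<open>e = 0\<close> and \<open>e = 1\<close> this forces the second vertex
  chosen for \<open>(i', j')\<close> to be at most and at least the first one chosen for \<open>(j', l)\<close>; for \<open>e = 2\<close> it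
  forces an admissible choice for \<open>(i', j')\<close>.\<close>

definition item_weight :: "nat \<Rightarrow> nat \<Rightarrow> (nat \<Rightarrow> nat \<Rightarrow> bool) \<Rightarrow> nat \<Rightarrow> nat \<Rightarrow> nat \<Rightarrow> nat" where
  "item_weight n k adj t d h =
    (let i = t div (n * n) div k; j = t div (n * n) mod k;
         a = t mod (n * n) div n; b = t mod (n * n) mod n; L = n * n - 1;
         i' = h div k div k mod k; j' = h div k mod k; l = h mod k in
     if h < k * k * k then
       (if d = 0 then (if i = i' \<and> j = j' then b else 0) + (if i = j' \<and> j = l then L - a else 0) else 0)
     else if h < 2 * (k * k * k) then
       (if d = 0 then (if i = i' \<and> j = j' then L - b else 0) + (if i = j' \<and> j = l then a else 0) else 0)
     else if i = i' \<and> j = j' \<and> (d = 1 \<or> \<not> (i = j \<or> adj a b)) then 1 else 0)"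

text \<open>Three families of \<open>k * k * k\<close> hubs. The load on a hub of the third family
  does not depend on \<open>l\<close>, so each of its tests occurs in \<open>k\<close> copies, which
  keeps the indexing uniform.\<close>

definition hub_count :: "nat \<Rightarrow> nat" where
  "hub_count k = 3 * (k * k * k)"

text \<open>The first summand covers all hub edges at one side of an item, the second keeps the
  padding weight a genuine difference, and the rest covers the \<open>hub_count k + 1\<close> edges
  at a vertex of the added clique.\<close>

definition max_load :: "nat \<Rightarrow> nat \<Rightarrow> nat" where
  "max_load n k = hub_count k * (2 * (n * n)) + n * n + hub_count k + 2"

text \<open>One further item per hub sends the same weight from both of its sides, which lowers the
  capacity of the hub from \<^term>\<open>max_load n k\<close> to \<open>n\<^sup>2 - 1\<close>.\<close>

definition padded_weight :: "nat \<Rightarrow> nat \<Rightarrow> (nat \<Rightarrow> nat \<Rightarrow> bool) \<Rightarrow> nat \<Rightarrow> nat \<Rightarrow> nat \<Rightarrow> nat" where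
  "padded_weight n k adj t d h =
    (if t < k * k * (n * n) then item_weight n k adj t d h
     else if h = t - k * k * (n * n) then max_load n k + 1 - n * n else 0)"

definition item_index :: "nat \<Rightarrow> nat \<Rightarrow> nat \<Rightarrow> nat \<Rightarrow> nat \<Rightarrow> nat \<Rightarrow> nat" where
  "item_index n k i j a b = (i * k + j) * (n * n) + (a * n + b)"

definition hub_index :: "nat \<Rightarrow> nat \<Rightarrow> nat \<Rightarrow> nat \<Rightarrow> nat \<Rightarrow> nat" where
  "hub_index k e i j l = ((e * k + i) * k + j) * k + l"

lemma digits_less:
  fixes a b m n :: nat
  assumes "a < m" "b < n"
  shows "a * n + b < m * n"
proof -
  have "a * n + b < (a + 1) * n"
    using assms(2) by simp
  also have "\<dots> \<le> m * n"
    using assms(1) by (intro mult_right_mono) auto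
  finally show ?thesis .
qed

lemma item_index_less:
  assumes "i < k" "j < k" "a < n" "b < n"
  shows "item_index n k i j a b < k * k * (n * n)"
  unfolding item_index_def by (intro digits_less assms)

lemma item_index_digits:
  assumes "j < k" "a < n" "b < n"
  shows "item_index n k i j a b div (n * n) div k = i" "item_index n k i j a b div (n * n) mod k = j"
    "item_index n k i j a b mod (n * n) div n = a" "item_index n k i j a b mod (n * n) mod n = b"
proof -
  have *: "a * n + b < n * n"
    using digits_less assms by blast
  then have "item_index n k i j a b div (n * n) = i * k + j" "item_index n k i j a b mod (n * n) = a * n + b"
    unfolding item_index_def by (simp_all only: div_mult_self3 mod_mult_self3) (use * in auto)
  then show "item_index n k i j a b div (n * n) div k = i" "item_index n k i j a b div (n * n) mod k = j"
    "item_index n k i j a b mod (n * n) div n = a" "item_index n k i j a b mod (n * n) mod n = b"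
    using assms by auto
qed

lemma item_index_of_digits:
  "item_index n k (t div (n * n) div k) (t div (n * n) mod k) (t mod (n * n) div n) (t mod (n * n) mod n) = t"
  by (simp only: item_index_def div_mult_mod_eq)

lemma item_digits_less:
  fixes t k n :: nat
  assumes "t < k * k * (n * n)"
  shows "t div (n * n) div k < k" "t div (n * n) mod k < k" "t mod (n * n) div n < n" "t mod (n * n) mod n < n"
proof -
  have "0 < k" "0 < n" "0 < n * n"
    using assms by (auto intro: gr0I)
  then show "t div (n * n) div k < k" "t div (n * n) mod k < k" "t mod (n * n) div n < n" "t mod (n * n) mod n < n"
    using assms by (simp_all add: less_mult_imp_div_less)
qed

lemma hub_index_digits:
  assumes "i < k" "j < k" "l < k"
  shows "hub_index k e i j l div k div k mod k = i" "hub_index k e i j l div k mod k = j"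
    "hub_index k e i j l mod k = l" "e * (k * k * k) \<le> hub_index k e i j l"
    "hub_index k e i j l < (e + 1) * (k * k * k)"
proof -
  have "hub_index k e i j l < (e + 1) * k * k * k"
    unfolding hub_index_def by (intro digits_less assms) simp_all
  then show "hub_index k e i j l < (e + 1) * (k * k * k)"
    by (simp add: ac_simps)
  show "e * (k * k * k) \<le> hub_index k e i j l"
    by (simp add: hub_index_def algebra_simps)
  show "hub_index k e i j l div k div k mod k = i" "hub_index k e i j l div k mod k = j"
    "hub_index k e i j l mod k = l"
    using assms by (simp_all add: hub_index_def)
qed

text \<open>If no admissible item were chosen for \<open>(i, j)\<close>, all \<open>n * n\<close>
  items of its block would load a hub of the third family with 1, which is one too many. Several
  items may be chosen for one pair; one admissible item is fixed for each, and since loads only add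
  up, the comparison hubs constrain the fixed ones.\<close>

lemma loads_imp_choice:
  assumes s: "\<And>t. s t < (2::nat)"
    and load: "\<And>h. h < hub_count k \<Longrightarrow> (\<Sum>t<k * k * (n * n). item_weight n k adj t (s t) h) < n * n"
  shows "\<exists>v. (\<forall>i<k. v i < n) \<and> (\<forall>i<k. \<forall>j<k. i \<noteq> j \<longrightarrow> adj (v i) (v j))"
proof -
  let ?R = "k * k * (n * n)" and ?L = "n * n - 1"
  have "\<exists>p. fst p < n \<and> snd p < n \<and> s (item_index n k i j (fst p) (snd p)) = 0 \<and> (i = j \<or> adj (fst p) (snd p))"
    if ij: "i < k" "j < k" for i j
  proof (rule ccontr)
    assume none: "\<not> ?thesis"
    have none': "\<not> (s (item_index n k i j a b) = 0 \<and> (i = j \<or> adj a b))" if "a < n" "b < n" for a b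
      using none that by (auto dest: spec[of _ "(a, b)"])
    let ?g = "(i * k + j) * (n * n)"
    \<comment> \<open>The last digit is arbitrary in the third family.\<close>
    let ?h = "hub_index k 2 i j 0"
    have h: "?h < hub_count k" "\<not> ?h < k * k * k" "\<not> ?h < 2 * (k * k * k)"
      "?h div k div k mod k = i" "?h div k mod k = j"
      using hub_index_digits[OF ij, of 0 2] ij by (auto simp: hub_count_def)
    have block: "item_weight n k adj t (s t) ?h = 1" "t < ?R" if t: "t \<in> {?g..<?g + n * n}" for t
    proof -
      define p where "p = t - ?g"
      have t_eq: "t = ?g + p" and p: "p < n * n"
        using t by (auto simp: p_def)
      have g: "t div (n * n) = i * k + j"
        unfolding t_eq using p by (cases "n * n = 0") auto
      have "n > 0"
        using p by (cases n) auto
      show "t < ?R"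
        unfolding t_eq by (intro digits_less ij p)
      have d: "t div (n * n) div k = i" "t div (n * n) mod k = j"
        using g ij by simp_all
      have "s t = 1 \<or> \<not> (i = j \<or> adj (t mod (n * n) div n) (t mod (n * n) mod n))"
        using none' item_digits_less(3,4)[OF \<open>t < ?R\<close>] item_index_of_digits[of n k t, unfolded d] s[of t]
        by (metis less_2_cases One_nat_def)
      then show "item_weight n k adj t (s t) ?h = 1"
        unfolding item_weight_def Let_def h(4,5) d using h(2,3) by auto
    qed
    have "n * n = (\<Sum>t\<in>{?g..<?g + n * n}. item_weight n k adj t (s t) ?h)"
      using block(1) by simp
    also have "\<dots> \<le> (\<Sum>t<?R. item_weight n k adj t (s t) ?h)"
      using block(2) by (intro sum_mono2) auto
    finally show False
      using load[OF h(1)] by simp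
  qed
  then obtain p where p: "\<And>i j. i < k \<Longrightarrow> j < k \<Longrightarrow> fst (p i j) < n \<and> snd (p i j) < n \<and>
      s (item_index n k i j (fst (p i j)) (snd (p i j))) = 0 \<and> (i = j \<or> adj (fst (p i j)) (snd (p i j)))"
    by metis
  define x y where "x i j = fst (p i j)" and "y i j = snd (p i j)" for i j
  have xy: "x i j < n" "y i j < n" "s (item_index n k i j (x i j) (y i j)) = 0" "i \<noteq> j \<Longrightarrow> adj (x i j) (y i j)"
    if "i < k" "j < k" for i j
    using p[OF that] by (auto simp: x_def y_def)
  have eq: "y i j = x j l" if ijl: "i < k" "j < k" "l < k" for i j l
  proof -
    let ?t1 = "item_index n k i j (x i j) (y i j)" and ?t2 = "item_index n k j l (x j l) (y j l)"
    have t1: "?t1 < ?R" "s ?t1 = 0" "?t1 div (n * n) div k = i" "?t1 div (n * n) mod k = j"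
      "?t1 mod (n * n) mod n = y i j"
      using item_index_less item_index_digits xy ijl by auto
    have t2: "?t2 < ?R" "s ?t2 = 0" "?t2 div (n * n) div k = j" "?t2 div (n * n) mod k = l"
      "?t2 mod (n * n) div n = x j l"
      using item_index_less item_index_digits xy ijl by auto
    \<comment> \<open>These bounds put both vertices at or below \<open>?L\<close>, so that the
      truncated differences from \<open>?L\<close> are exact.\<close>
    have n: "x j l < n" "y i j < n" "n \<le> n * n"
      using xy ijl by auto
    \<comment> \<open>The two items coincide when \<open>i = j = l\<close>; a single item then
      brings both contributions, hence the separate condition.\<close>
    have bound: "A + B \<le> ?L"
      if "h < hub_count k" and "\<And>t. t = ?t1 \<Longrightarrow> t \<noteq> ?t2 \<Longrightarrow> A \<le> item_weight n k adj t (s t) h"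
        "\<And>t. t = ?t2 \<Longrightarrow> t \<noteq> ?t1 \<Longrightarrow> B \<le> item_weight n k adj t (s t) h"
        "\<And>t. t = ?t1 \<Longrightarrow> t = ?t2 \<Longrightarrow> A + B \<le> item_weight n k adj t (s t) h" for h A B
    proof -
      have "A + B = (\<Sum>t<?R. (if t = ?t1 then A else 0) + (if t = ?t2 then B else 0))"
        using t1(1) t2(1) by (simp add: sum.distrib)
      also have "\<dots> \<le> (\<Sum>t<?R. item_weight n k adj t (s t) h)"
        by (intro sum_mono) (use that(2-4) in auto)
      finally show ?thesis
        using load[OF that(1)] by simp
    qed
    have "y i j + (?L - x j l) \<le> ?L"
    proof (rule bound[of "hub_index k 0 i j l"])
      show "hub_index k 0 i j l < hub_count k"
        using hub_index_digits(5)[OF ijl, of 0] by (simp add: hub_count_def)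
    qed (use hub_index_digits[OF ijl, of 0] t1 t2 in \<open>auto simp: item_weight_def Let_def\<close>)
    moreover have "(?L - y i j) + x j l \<le> ?L"
    proof (rule bound[of "hub_index k 1 i j l"])
      show "hub_index k 1 i j l < hub_count k"
        using hub_index_digits(5)[OF ijl, of 1] by (simp add: hub_count_def)
    qed (use hub_index_digits[OF ijl, of 1] t1 t2 in \<open>auto simp: item_weight_def Let_def\<close>)
    ultimately show ?thesis
      using n by linarith
  qed
  \<comment> \<open>Both \<open>x i j\<close> and \<open>x i i\<close> equal \<open>y i i\<close>,
    so the first vertex depends on \<open>i\<close> only; then \<open>y i j = x j j\<close>
    identifies the second vertex with the member at position \<open>j\<close>.\<close>
  have "x i j = x i i" "y i j = x j j" if "i < k" "j < k" for i j
    using eq[of i i j] eq[of i i i] eq[of i j j] that by auto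
  then show ?thesis
    using xy by (intro exI[of _ "\<lambda>i. x i i"]) metis
qed

text \<open>Exactly one item per pair is chosen. A hub of the first two families then receives
  \<open>v j\<close> from one item and the complement to \<open>n * n - 1\<close> from another (or
  both from the same item). A hub of the third family receives 1 from each item of its block except
  the chosen one, again \<open>n * n - 1\<close> in total.\<close>

lemma choice_imp_loads:
  assumes v: "\<And>i. i < k \<Longrightarrow> v i < n" "\<And>i j. i < k \<Longrightarrow> j < k \<Longrightarrow> i \<noteq> j \<Longrightarrow> adj (v i) (v j)"
  shows "\<exists>s. (\<forall>t. s t < (2::nat)) \<and>
    (\<forall>h<hub_count k. (\<Sum>t<k * k * (n * n). item_weight n k adj t (s t) h) < n * n)"
proof -
  let ?R = "k * k * (n * n)" and ?L = "n * n - 1"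
  define s :: "nat \<Rightarrow> nat" where
    "s t = (if t mod (n * n) div n = v (t div (n * n) div k) \<and> t mod (n * n) mod n = v (t div (n * n) mod k)
      then 0 else 1)" for t
  define u where "u i j = item_index n k i j (v i) (v j)" for i j
  have t_eq: "t = u i j" if "s t = 0" "t div (n * n) div k = i" "t div (n * n) mod k = j" for t i j
    using that item_index_of_digits[of n k t] unfolding s_def u_def by (metis zero_neq_one)
  have sv: "t mod (n * n) div n = v (t div (n * n) div k)" "t mod (n * n) mod n = v (t div (n * n) mod k)"
    if "s t = 0" for t
    using that by (auto simp: s_def split: if_splits)
  have "(\<Sum>t<?R. item_weight n k adj t (s t) h) < n * n" if h: "h < hub_count k" for h
  proof -
    define i j l where "i = h div k div k mod k" and "j = h div k mod k" and "l = h mod k"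
    have "0 < k"
      using h by (cases k) (auto simp: hub_count_def)
    then have ijl: "i < k" "j < k" "l < k"
      by (auto simp: i_def j_def l_def)
    have u: "u i j < ?R" "u j l < ?R"
      unfolding u_def using ijl v by (auto intro!: item_index_less)
    have n: "v j < n" "0 < n" "n \<le> n * n"
      using v(1)[OF ijl(2)] by auto
    have *: "(\<Sum>t<?R. item_weight n k adj t (s t) h) < n * n"
      if "A + B \<le> ?L"
        "\<And>t. item_weight n k adj t (s t) h \<le> (if t = u i j then A else 0) + (if t = u j l then B else 0)" for A B
    proof -
      have "(\<Sum>t<?R. item_weight n k adj t (s t) h) \<le>
          (\<Sum>t<?R. (if t = u i j then A else 0) + (if t = u j l then B else 0))"
        by (intro sum_mono that(2))
      also have "\<dots> = A + B"
        using u by (simp add: sum.distrib)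
      finally show ?thesis
        using that(1) n by (cases "n * n") auto
    qed
    consider "h < k * k * k" | "\<not> h < k * k * k" "h < 2 * (k * k * k)"
      | "\<not> h < k * k * k" "\<not> h < 2 * (k * k * k)"
      by blast
    then show ?thesis
    proof cases
      case 1
      show ?thesis
      proof (rule *[of "v j" "?L - v j"])
        fix t
        show "item_weight n k adj t (s t) h \<le> (if t = u i j then v j else 0) + (if t = u j l then ?L - v j else 0)"
        proof (cases "s t = 0")
          case True
          obtain i' j' where d: "t div (n * n) div k = i'" "t div (n * n) mod k = j'"
            by blast
          have "i' = i \<Longrightarrow> j' = j \<Longrightarrow> t = u i j" "i' = j \<Longrightarrow> j' = l \<Longrightarrow> t = u j l"
            using t_eq[OF True] d by blast+
          then show ?thesis
            unfolding item_weight_def Let_def i_def[symmetric] j_def[symmetric] l_def[symmetric]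
              sv[OF True] d using 1 by auto
        qed (use 1 in \<open>simp add: item_weight_def Let_def\<close>)
      qed (use n in linarith)
    next
      case 2
      show ?thesis
      proof (rule *[of "?L - v j" "v j"])
        fix t
        show "item_weight n k adj t (s t) h \<le> (if t = u i j then ?L - v j else 0) + (if t = u j l then v j else 0)"
        proof (cases "s t = 0")
          case True
          obtain i' j' where d: "t div (n * n) div k = i'" "t div (n * n) mod k = j'"
            by blast
          have "i' = i \<Longrightarrow> j' = j \<Longrightarrow> t = u i j" "i' = j \<Longrightarrow> j' = l \<Longrightarrow> t = u j l"
            using t_eq[OF True] d by blast+
          then show ?thesis
            unfolding item_weight_def Let_def i_def[symmetric] j_def[symmetric] l_def[symmetric]
              sv[OF True] d using 2 by auto
        qed (use 2 in \<open>simp add: item_weight_def Let_def\<close>)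
      qed (use n in linarith)
    next
      case 3
      let ?g = "(i * k + j) * (n * n)"
      let ?B = "{?g..<?g + n * n}"
      have uB: "u i j \<in> ?B"
        unfolding u_def item_index_def using digits_less[of "v i" n "v j" n] v ijl by simp
      have su: "s (u i j) = 0"
        unfolding s_def u_def using ijl v by (simp add: item_index_digits)
      have gt: "?g = t div (n * n) * (n * n)" if "t div (n * n) div k = i" "t div (n * n) mod k = j" for t
        using that by (metis div_mult_mod_eq)
      have tB: "t \<in> ?B" if "t div (n * n) div k = i" "t div (n * n) mod k = j" for t
      proof -
        have "t = ?g + t mod (n * n)"
          unfolding gt[OF that] by (rule div_mult_mod_eq[symmetric])
        moreover have "t mod (n * n) < n * n"
          using n by simp
        ultimately show ?thesis
          unfolding atLeastLessThan_iff by linarith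
      qed
      have "item_weight n k adj t (s t) h \<le> (if t \<in> ?B - {u i j} then 1 else 0)" for t
      proof (cases "item_weight n k adj t (s t) h = 0")
        case False
        then have t: "t div (n * n) div k = i" "t div (n * n) mod k = j" "item_weight n k adj t (s t) h = 1"
          "s t = 1 \<or> \<not> (i = j \<or> adj (t mod (n * n) div n) (t mod (n * n) mod n))"
          unfolding item_weight_def Let_def i_def[symmetric] j_def[symmetric] l_def[symmetric]
          using 3 by (auto split: if_splits)
        have "s t \<noteq> 0"
        proof
          assume "s t = 0"
          then show False
            using t(4) v(2)[OF ijl(1,2)] unfolding sv[OF \<open>s t = 0\<close>] t(1,2) by auto
        qed
        then show ?thesis
          using tB[OF t(1,2)] t(3) su by auto
      qed simp
      then have "(\<Sum>t<?R. item_weight n k adj t (s t) h) \<le> (\<Sum>t<?R. if t \<in> ?B - {u i j} then 1 else 0)"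
        by (intro sum_mono)
      also have "\<dots> = (\<Sum>t | t \<in> {..<?R} \<and> t \<in> ?B - {u i j}. 1)"
        by (rule sum.inter_filter[symmetric]) simp
      also have "\<dots> \<le> card (?B - {u i j})"
        unfolding card_eq_sum by (intro sum_mono2) auto
      also have "\<dots> = ?L"
        using uB by simp
      finally show ?thesis
        using n by (cases "n * n") auto
    qed
  qed
  moreover have "s t < 2" for t
    by (simp add: s_def)
  ultimately show ?thesis
    by blast
qed

lemma padded_loads_iff:
  "(\<forall>h<hub_count k. (\<Sum>t<k * k * (n * n) + hub_count k. padded_weight n k adj t (s t) h) \<le> max_load n k) \<longleftrightarrow>
   (\<forall>h<hub_count k. (\<Sum>t<k * k * (n * n). item_weight n k adj t (s t) h) < n * n)"
proof -
  let ?R = "k * k * (n * n)"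
  have "(\<Sum>t<?R + hub_count k. padded_weight n k adj t (s t) h) =
      (\<Sum>t<?R. item_weight n k adj t (s t) h) + (max_load n k + 1 - n * n)" if "h < hub_count k" for h
  proof -
    have "(\<Sum>t<?R + hub_count k. padded_weight n k adj t (s t) h) =
        (\<Sum>t<?R. padded_weight n k adj t (s t) h) + (\<Sum>q<hub_count k. padded_weight n k adj (?R + q) (s (?R + q)) h)"
      using sum_vertices[of "\<lambda>t. padded_weight n k adj t (s t) h" ?R 0 "hub_count k"] by simp
    also have "(\<Sum>q<hub_count k. padded_weight n k adj (?R + q) (s (?R + q)) h) = max_load n k + 1 - n * n"
      using that by (simp add: padded_weight_def)
    finally show ?thesis
      by (simp add: padded_weight_def)
  qed
  moreover have "x + (max_load n k + 1 - n * n) \<le> max_load n k \<longleftrightarrow> x < n * n" for x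
  proof -
    have "n * n \<le> max_load n k"
      by (simp add: max_load_def)
    then show ?thesis
      by linarith
  qed
  ultimately show ?thesis
    by simp
qed

lemma item_weight_le:
  assumes "t < k * k * (n * n)"
  shows "item_weight n k adj t d h \<le> 2 * (n * n)"
proof -
  have if_le: "(if P then x else y) \<le> c" if "x \<le> c" "y \<le> c" for P and x y c :: nat
    using that by simp
  obtain a b where ab: "t mod (n * n) div n = a" "t mod (n * n) mod n = b"
    by blast
  have "a < n" "b < n"
    using item_digits_less(3,4)[OF assms] ab by auto
  moreover have "n \<le> n * n"
    by simp
  ultimately have *: "a \<le> n * n" "b \<le> n * n" "1 \<le> n * n"
    by linarith+
  show ?thesis
    unfolding item_weight_def Let_def ab mult_2
    by (intro if_le add_mono) (use * in linarith)+
qed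

text \<open>This is the capacity condition at a side that does not carry its item edge. For
  \<open>n = 0\<close> a padding item would weigh \<open>max_load n k + 1\<close>.\<close>

lemma sum_padded_weight_le:
  assumes "0 < n" "t < k * k * (n * n) + hub_count k"
  shows "(\<Sum>h<hub_count k. padded_weight n k adj t d h) \<le> max_load n k"
proof (cases "t < k * k * (n * n)")
  case True
  then have "(\<Sum>h<hub_count k. padded_weight n k adj t d h) \<le> hub_count k * (2 * (n * n))"
    using sum_bounded_above[of "{..<hub_count k}" "padded_weight n k adj t d" "2 * (n * n)"]
      item_weight_le[OF True] by (simp add: padded_weight_def)
  then show ?thesis
    by (simp add: max_load_def)
next
  case False
  have "(\<Sum>h<hub_count k. padded_weight n k adj t d h) =
      (\<Sum>h<hub_count k. if h = t - k * k * (n * n) then max_load n k + 1 - n * n else 0)"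
    using False by (simp add: padded_weight_def)
  also have "\<dots> \<le> max_load n k + 1 - n * n"
    by simp
  also have "\<dots> \<le> max_load n k"
    using assms(1) by (cases "n * n") auto
  finally show ?thesis .
qed

definition item_count :: "nat \<Rightarrow> nat \<Rightarrow> nat" where
  "item_count n k = k * k * (n * n) + hub_count k"

definition vertex_count :: "nat \<Rightarrow> nat \<Rightarrow> nat" where
  "vertex_count n k = hub_count k + 2 * item_count n k + (hub_count k + 2)"

definition reduction_weight :: "nat \<Rightarrow> nat \<Rightarrow> (nat \<Rightarrow> nat \<Rightarrow> bool) \<Rightarrow> nat \<Rightarrow> nat \<Rightarrow> nat" where
  "reduction_weight n k adj =
     gadget_weight (hub_count k) (item_count n k) (max_load n k) (padded_weight n k adj)"

lemma reduction_orientable_iff: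
  "orientable (vertex_count n k) (reduction_weight n k adj) (max_load n k) \<longleftrightarrow>
    (\<exists>v. (\<forall>i<k. v i < n) \<and> (\<forall>i<k. \<forall>j<k. i \<noteq> j \<longrightarrow> adj (v i) (v j)))"
    (is "?L \<longleftrightarrow> ?R")
proof
  have r: "0 < max_load n k" "hub_count k + 1 \<le> max_load n k"
    by (simp_all add: max_load_def)
  show ?R if ?L
    using gadget_orientable_iff(1)[OF r that[unfolded vertex_count_def reduction_weight_def]]
    unfolding item_count_def padded_loads_iff using loads_imp_choice[of _ k n adj] by blast
  show ?L if R: ?R
  proof -
    obtain v where v: "\<And>i. i < k \<Longrightarrow> v i < n" "\<And>i j. i < k \<Longrightarrow> j < k \<Longrightarrow> i \<noteq> j \<Longrightarrow> adj (v i) (v j)"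
      using R by blast
    have "(\<Sum>h<hub_count k. padded_weight n k adj t d h) \<le> max_load n k" if "t < item_count n k" for t d
    proof (cases "0 < n")
      case True
      then show ?thesis
        using sum_padded_weight_le that by (simp add: item_count_def)
    next
      \<comment> \<open>In a graph without vertices a choice exists only for \<open>k = 0\<close>,
        and then there are no hubs.\<close>
      case False
      then have "k = 0"
        using v(1)[of 0] by (cases k) auto
      then show ?thesis
        by (simp add: hub_count_def)
    qed
    then show ?thesis
      unfolding vertex_count_def reduction_weight_def
      using choice_imp_loads[of k v n adj, OF v]
      by (intro gadget_orientable_iff(2)[OF r]) (auto simp: item_count_def padded_loads_iff)
  qed
qed

lemma clique_iff_choice:
  assumes "simple_graph {0..<n} E"
  shows "(\<exists>S. S \<subseteq> {0..<n} \<and> card S = k \<and> clique E S) \<longleftrightarrow>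
    (\<exists>v. (\<forall>i<k. v i < n) \<and> (\<forall>i<k. \<forall>j<k. i \<noteq> j \<longrightarrow> {v i, v j} \<in> E))"
    (is "?L \<longleftrightarrow> ?R")
proof
  assume ?L
  then obtain S where S: "S \<subseteq> {0..<n}" "card S = k" "clique E S"
    by blast
  have "finite S"
    using S(1) by (rule finite_subset) simp
  then obtain v where v: "bij_betw v {0..<k} S"
    using ex_bij_betw_nat_finite[of S] S(2) by blast
  have vS: "v i \<in> S" if "i < k" for i
    using bij_betw_apply[OF v, of i] that by simp
  have "{v i, v j} \<in> E" if "i < k" "j < k" "i \<noteq> j" for i j
  proof -
    have "v i \<noteq> v j"
      using bij_betw_imp_inj_on[OF v] that by (simp add: inj_on_eq_iff)
    then show ?thesis
      using S(3) vS that by (simp add: clique_def)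
  qed
  moreover have "v i < n" if "i < k" for i
    using S(1) vS[OF that] by auto
  ultimately show ?R
    by blast
next
  assume ?R
  then obtain v where v: "\<And>i. i < k \<Longrightarrow> v i < n" "\<And>i j. i < k \<Longrightarrow> j < k \<Longrightarrow> i \<noteq> j \<Longrightarrow> {v i, v j} \<in> E"
    by blast
  \<comment> \<open>Edges have two elements, so adjacent members are different.\<close>
  have "inj_on v {..<k}"
  proof (rule inj_onI, rule ccontr)
    fix i j assume ij: "i \<in> {..<k}" "j \<in> {..<k}" "v i = v j" "i \<noteq> j"
    then have "card {v i, v j} = 2"
      using v(2)[of i j] assms by (auto simp: simple_graph_def)
    then show False
      using ij by simp
  qed
  then have "card (v ` {..<k}) = k"
    by (simp add: card_image)
  moreover have "clique E (v ` {..<k})"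
    unfolding clique_def using v(2) by blast
  ultimately show ?L
    using v(1) by (intro exI[of _ "v ` {..<k}"]) auto
qed

subsection \<open>Encodings and expressibility of the reduction\<close>

text \<open>The unary code is prefix-free, which makes concatenations of such codes uniquely
  decodable.\<close>

lemma unary_append_eqD: "unary m @ xs = unary n @ ys \<Longrightarrow> m = n \<and> xs = ys"
proof (induction m arbitrary: n)
  case 0
  then show ?case
    by (cases n) (auto simp: unary_def)
next
  case (Suc m)
  then obtain n' where "n = Suc n'"
    by (cases n) (auto simp: unary_def)
  then show ?case
    using Suc by (auto simp: unary_def)
qed

lemma concat_append_eqD:
  assumes "\<And>i xs ys. i \<in> set is \<Longrightarrow> f i @ xs = g i @ ys \<Longrightarrow> P i \<and> xs = ys"
  shows "concat (map f is) @ xs = concat (map g is) @ ys \<Longrightarrow> (\<forall>i\<in>set is. P i) \<and> xs = ys"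
  using assms
proof (induction "is")
  case (Cons i "is")
  have "P i \<and> concat (map f is) @ xs = concat (map g is) @ ys"
    using Cons.prems(2)[of i] Cons.prems(1) by simp
  then show ?case
    using Cons.IH Cons.prems(2) by auto
qed simp

lemma binary_inject: "binary m = binary n \<Longrightarrow> m = n"
proof (induction m arbitrary: n rule: less_induct)
  case (less m)
  show ?case
  proof (cases "m = 0 \<or> n = 0")
    case True
    then show ?thesis
      using less.prems by (auto simp: binary.simps split: if_splits)
  next
    case False
    then have "odd m = odd n" "binary (m div 2) = binary (n div 2)"
      using less.prems by (auto simp: binary.simps[of m] binary.simps[of n])
    moreover from this(2) have "m div 2 = n div 2"
      using less.IH[of "m div 2"] False by simp
    ultimately show ?thesis
      by (metis bit_eq_rec even_iff_mod_2_eq_zero)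
  qed
qed

text \<open>A yes-instance is given by the existence of some graph with the given encoding, so
  unique decoding is what ties the answer to one particular graph. The number of matrix entries is
  known from the prefix, hence the binary rest is well delimited.\<close>

lemma encode_weighted_graph_inject:
  assumes "simple_graph {0..<n} E" "edge_weighting E w" "simple_graph {0..<n'} E'" "edge_weighting E' w'"
    and eq: "encode_weighted_graph n E w @ binary r = encode_weighted_graph n' E' w' @ binary r'"
  shows "n = n'" "r = r'" "E = E'" "\<And>e. e \<in> E \<Longrightarrow> w e = w' e"
proof -
  let ?f = "\<lambda>E w i j. if {i, j} \<in> E then w {i, j} else (0::nat)"
  let ?g = "\<lambda>E w n. concat (map (\<lambda>i. concat (map (\<lambda>j. unary (?f E w i j)) [0..<n])) [0..<n])"
  have n: "n = n' \<and> ?g E w n @ binary r = ?g E' w' n' @ binary r'"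
    using eq unfolding encode_weighted_graph_def append_assoc by (rule unary_append_eqD)
  then show "n = n'"
    by simp
  with n have rows: "?g E w n @ binary r = ?g E' w' n @ binary r'"
    by simp
  have concat_eq: "(\<forall>i\<in>set [0..<n]. \<forall>j\<in>set [0..<n]. ?f E w i j = ?f E' w' i j) \<and> binary r = binary r'"
    by (rule concat_append_eqD[OF _ rows], rule concat_append_eqD, erule unary_append_eqD, assumption)
  then have f: "?f E w i j = ?f E' w' i j" if "i < n" "j < n" for i j
    using that by auto
  show "r = r'"
    using concat_eq by (blast dest: binary_inject)
  have *: "e \<in> E \<longleftrightarrow> e \<in> E'" "e \<in> E \<Longrightarrow> w e = w' e" if "e \<in> E \<or> e \<in> E'" for e
  proof -
    have "e \<subseteq> {0..<n}" "card e = 2"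
      using that assms \<open>n = n'\<close> by (auto simp: simple_graph_def)
    then obtain i j where e: "e = {i, j}" "i < n" "j < n"
      by (auto simp: card_2_iff)
    show "e \<in> E \<longleftrightarrow> e \<in> E'" "e \<in> E \<Longrightarrow> w e = w' e"
      using f[OF e(2,3)] assms(2,4) unfolding e(1)[symmetric] edge_weighting_def
      by (auto split: if_splits)
  qed
  then show "E = E'" "\<And>e. e \<in> E \<Longrightarrow> w e = w' e"
    by auto
qed

lemma instanceI:
  assumes "simple_graph {0..<n} E" "edge_weighting E w" "0 < r"
  shows "(encode_weighted_graph n E w @ binary r, treewidth {0..<n} E)
    \<in> instances MIN_MAX_OUTDEGREE_treewidth"
  using assms unfolding MIN_MAX_OUTDEGREE_treewidth_def para_problem.simps mem_Collect_eq
  by (intro exI[of _ n] exI[of _ E] exI[of _ w] exI[of _ r] conjI refl)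

lemma yes_instance_iff:
  assumes "simple_graph {0..<n} E" "edge_weighting E w" "0 < r"
  shows "(encode_weighted_graph n E w @ binary r, treewidth {0..<n} E)
      \<in> yes_instances MIN_MAX_OUTDEGREE_treewidth \<longleftrightarrow>
    (\<exists>\<Lambda>. orientation E \<Lambda> \<and> (\<forall>v\<in>{0..<n}. weighted_outdegree E w \<Lambda> v \<le> r))"
    (is "?yes \<longleftrightarrow> ?R")
proof
  assume ?yes
  then obtain n' E' w' r' \<Lambda> where
    eq: "encode_weighted_graph n E w @ binary r = encode_weighted_graph n' E' w' @ binary r'"
    and E': "simple_graph {0..<n'} E'" "edge_weighting E' w'"
    and \<Lambda>: "orientation E' \<Lambda>" "\<forall>v\<in>{0..<n'}. weighted_outdegree E' w' \<Lambda> v \<le> r'"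
    unfolding MIN_MAX_OUTDEGREE_treewidth_def by auto
  note same = encode_weighted_graph_inject[OF assms(1,2) E' eq]
  have "weighted_outdegree E w \<Lambda> v = weighted_outdegree E' w' \<Lambda> v" for v
    unfolding weighted_outdegree_def same(3)[symmetric] by (rule sum.cong) (auto simp: same(4))
  then show ?R
    using \<Lambda> same(1-3) by auto
next
  assume ?R
  then show ?yes
    using assms unfolding MIN_MAX_OUTDEGREE_treewidth_def para_problem.simps mem_Collect_eq
    by (intro exI[of _ n] exI[of _ E] exI[of _ w] exI[of _ r] conjI refl)
qed

lemma nth_concat_rows:
  "a < m \<Longrightarrow> b < n \<Longrightarrow> concat (map (\<lambda>i. map (f i) [0..<n]) [0..<m]) ! (a * n + b) = f a b"
proof (induction m)
  case (Suc m)
  have len: "length (concat (map (\<lambda>i. map (f i) [0..<n]) [0..<m])) = m * n"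
    by (induction m) auto
  show ?case
  proof (cases "a < m")
    case True
    then show ?thesis
      using Suc digits_less[of a m b n] len by (simp add: nth_append)
  next
    case False
    then have "a = m"
      using Suc.prems by simp
    then show ?thesis
      using Suc.prems len by (simp add: nth_append)
  qed
qed simp

lemma length_rows: "length (concat (map (\<lambda>i. map (f i) [0..<n]) [0..<m])) = m * n"
  by (induction m) auto

lemma encode_graph_cells:
  fixes n :: nat and E
  defines "x \<equiv> encode_graph n E"
  shows "n < length x" "i < n \<Longrightarrow> string_cell x i = 2" "string_cell x n = 1"
    "a < n \<Longrightarrow> b < n \<Longrightarrow> string_cell x (n + 1 + (a * n + b)) = 2 \<longleftrightarrow> {a, b} \<in> E"
proof -
  let ?rows = "concat (map (\<lambda>i. map (\<lambda>j. {i, j} \<in> E) [0..<n]) [0..<n])"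
  have x: "x = (replicate n True @ [False]) @ ?rows"
    by (simp add: x_def encode_graph_def unary_def)
  show "n < length x" "i < n \<Longrightarrow> string_cell x i = 2" "string_cell x n = 1"
    unfolding x by (simp_all add: string_cell_def nth_append)
  show "string_cell x (n + 1 + (a * n + b)) = 2 \<longleftrightarrow> {a, b} \<in> E" if "a < n" "b < n"
  proof -
    have "x ! (n + 1 + (a * n + b)) = ?rows ! (a * n + b)"
      unfolding x by (subst nth_append) simp
    moreover have "n + 1 + (a * n + b) < length x"
      unfolding x using digits_less[OF that] length_rows[of "\<lambda>i j. {i, j} \<in> E" n n] by simp
    ultimately show ?thesis
      using nth_concat_rows[OF that, of "\<lambda>i j. {i, j} \<in> E"] by (simp add: string_cell_def)
  qed
qed

section \<open>Closure properties of the functions given by expressions\<close>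

text \<open>Speaking of functions instead of syntax allows a weight to be recognised as expressible
  by introduction rules that follow its definition, without writing the expression down.\<close>

definition polyfun :: "((nat \<Rightarrow> nat) \<Rightarrow> (nat \<Rightarrow> nat) \<Rightarrow> nat) \<Rightarrow> bool" where
  "polyfun f \<longleftrightarrow> (\<exists>e. feval e = f)"

definition polypred :: "((nat \<Rightarrow> nat) \<Rightarrow> (nat \<Rightarrow> nat) \<Rightarrow> bool) \<Rightarrow> bool" where
  "polypred P \<longleftrightarrow> polyfun (\<lambda>I v. if P I v then 1 else 0)"

lemma polyfunI: "(\<And>I v. feval e I v = f I v) \<Longrightarrow> polyfun f"
  unfolding polyfun_def by blast

lemma polyfunE:
  assumes "polyfun f"
  obtains e where "\<And>I v. feval e I v = f I v"
  using assms unfolding polyfun_def by blast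

lemma polyfun_const: "polyfun (\<lambda>I v. n)"
  by (rule polyfunI[of "Num n"]) simp

lemma polyfun_var: "polyfun (\<lambda>I v. v x)"
  by (rule polyfunI[of "Var x"]) simp

lemma polyfun_inp:
  assumes "polyfun f"
  shows "polyfun (\<lambda>I v. I (f I v))"
proof -
  obtain e where "\<And>I v. feval e I v = f I v"
    using polyfunE[OF assms] by blast
  then show ?thesis
    by (intro polyfunI[of "Inp e"]) simp
qed

lemma polyfun_add:
  assumes "polyfun f" "polyfun g"
  shows "polyfun (\<lambda>I v. f I v + g I v)"
proof -
  obtain e e' where "\<And>I v. feval e I v = f I v" "\<And>I v. feval e' I v = g I v"
    using polyfunE assms by metis
  then show ?thesis
    by (intro polyfunI[of "Add e e'"]) simp
qed

lemma polyfun_diff: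
  assumes "polyfun f" "polyfun g"
  shows "polyfun (\<lambda>I v. f I v - g I v)"
proof -
  obtain e e' where "\<And>I v. feval e I v = f I v" "\<And>I v. feval e' I v = g I v"
    using polyfunE assms by metis
  then show ?thesis
    by (intro polyfunI[of "Sub e e'"]) simp
qed

text \<open>Only finitely many variables occur in an expression, so all sufficiently large ones are
  available as bound variables.\<close>

lemma feval_fresh: "\<exists>y. \<forall>x\<ge>y. \<forall>I v i. feval e I (v(x := i)) = feval e I v"
proof (induction e)
  case (Var z)
  then show ?case
    by (intro exI[of _ "Suc z"]) auto
next
  case (Inp e)
  then obtain y where "\<forall>x\<ge>y. \<forall>I v i. feval e I (v(x := i)) = feval e I v"
    by blast
  then show ?case
    by (intro exI[of _ y]) (simp del: fun_upd_apply)
next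
  case (Add e1 e2)
  then obtain y1 y2 where "\<forall>x\<ge>y1. \<forall>I v i. feval e1 I (v(x := i)) = feval e1 I v"
    "\<forall>x\<ge>y2. \<forall>I v i. feval e2 I (v(x := i)) = feval e2 I v"
    by blast
  then show ?case
    by (intro exI[of _ "max y1 y2"]) (simp del: fun_upd_apply)
next
  case (Sub e1 e2)
  then obtain y1 y2 where "\<forall>x\<ge>y1. \<forall>I v i. feval e1 I (v(x := i)) = feval e1 I v"
    "\<forall>x\<ge>y2. \<forall>I v i. feval e2 I (v(x := i)) = feval e2 I v"
    by blast
  then show ?case
    by (intro exI[of _ "max y1 y2"]) (simp del: fun_upd_apply)
next
  case (Sum z e1 e2)
  then obtain y1 y2 where y: "\<forall>x\<ge>y1. \<forall>I v i. feval e1 I (v(x := i)) = feval e1 I v"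
    "\<forall>x\<ge>y2. \<forall>I v i. feval e2 I (v(x := i)) = feval e2 I v"
    by blast
  have "feval (Sum z e1 e2) I (v(x := i)) = feval (Sum z e1 e2) I v"
    if "x \<ge> max (Suc z) (max y1 y2)" for x I v i
  proof -
    have "feval e2 I ((v(x := i))(z := j)) = feval e2 I (v(z := j))" for j
      using y(2) that by (subst fun_upd_twist) auto
    then show ?thesis
      using y(1) that by simp
  qed
  then show ?case
    by blast
qed auto

text \<open>The summand is a function of an index, not of a variable. It is evaluated with the index
  stored in a variable \<open>x\<close> on which \<open>g\<close> does not otherwise depend.\<close>

lemma polyfun_sum:
  assumes "polyfun f" and g: "\<And>x. polyfun (\<lambda>I v. g I v (v x))"
    and fresh: "\<exists>y. \<forall>x\<ge>y. \<forall>I v i j. g I (v(x := i)) j = g I v j"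
  shows "polyfun (\<lambda>I v. \<Sum>i<f I v. g I v i)"
proof -
  obtain x where x: "\<And>I v i j. g I (v(x := i)) j = g I v j"
    using fresh by blast
  obtain e where e: "\<And>I v. feval e I v = f I v"
    using polyfunE[OF assms(1)] by blast
  obtain e' where "\<And>I v. feval e' I v = g I v (v x)"
    using polyfunE[OF g[of x]] by blast
  then show ?thesis
    by (intro polyfunI[of "Sum x e e'"]) (simp add: e x)
qed

lemma polyfun_fresh:
  assumes "polyfun f"
  shows "\<exists>y. \<forall>x\<ge>y. \<forall>I v i. f I (v(x := i)) = f I v"
proof -
  obtain e where "feval e = f"
    using assms unfolding polyfun_def by blast
  then show ?thesis
    using feval_fresh[of e] by (simp only:)
qed

lemma polyfun_fresh2:
  assumes "polyfun f" "polyfun g"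
  shows "\<exists>y. \<forall>x\<ge>y. (\<forall>I v i. f I (v(x := i)) = f I v) \<and> (\<forall>I v i. g I (v(x := i)) = g I v)"
proof -
  obtain y1 y2 where "\<forall>x\<ge>y1. \<forall>I v i. f I (v(x := i)) = f I v" "\<forall>x\<ge>y2. \<forall>I v i. g I (v(x := i)) = g I v"
    using polyfun_fresh[OF assms(1)] polyfun_fresh[OF assms(2)] by blast
  then show ?thesis
    by (intro exI[of _ "max y1 y2"]) (simp del: fun_upd_apply)
qed

lemma polyfun_mult:
  assumes "polyfun f" "polyfun g"
  shows "polyfun (\<lambda>I v. f I v * g I v)"
proof -
  have "polyfun (\<lambda>I v. \<Sum>i<f I v. g I v)"
    by (rule polyfun_sum[OF assms(1), where g = "\<lambda>I v _. g I v", OF assms(2)])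
      (use polyfun_fresh[OF assms(2)] in simp)
  then show ?thesis
    by simp
qed

text \<open>Truncated subtraction from 1 acts as negation and turns any positive number into
  0.\<close>

lemma polypred_less:
  assumes "polyfun f" "polyfun g"
  shows "polypred (\<lambda>I v. f I v < g I v)"
proof -
  have "polyfun (\<lambda>I v. 1 - (1 - (g I v - f I v)))"
    by (intro polyfun_diff polyfun_const assms)
  moreover have "1 - (1 - (b - a)) = (if a < b then 1 else 0)" for a b :: nat
    by simp
  ultimately show ?thesis
    unfolding polypred_def by simp
qed

lemma polypred_not:
  assumes "polypred P"
  shows "polypred (\<lambda>I v. \<not> P I v)"
proof -
  have "polyfun (\<lambda>I v. 1 - (if P I v then 1 else 0))"
    by (intro polyfun_diff polyfun_const assms[unfolded polypred_def])
  moreover have "1 - (if p then 1 else 0) = (if \<not> p then 1 else (0::nat))" for p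
    by simp
  ultimately show ?thesis
    unfolding polypred_def by simp
qed

lemma polypred_conj:
  assumes "polypred P" "polypred Q"
  shows "polypred (\<lambda>I v. P I v \<and> Q I v)"
proof -
  have "polyfun (\<lambda>I v. (if P I v then 1 else 0) * (if Q I v then 1 else 0))"
    by (intro polyfun_mult assms[unfolded polypred_def])
  moreover have "(if p then 1 else 0) * (if q then 1 else 0) = (if p \<and> q then 1 else (0::nat))" for p q
    by simp
  ultimately show ?thesis
    unfolding polypred_def by (simp only:)
qed

lemma polypred_disj: "polypred P \<Longrightarrow> polypred Q \<Longrightarrow> polypred (\<lambda>I v. P I v \<or> Q I v)"
  using polypred_not[OF polypred_conj[OF polypred_not polypred_not, of P Q]] by simp

lemma polypred_eq:
  assumes "polyfun f" "polyfun g"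
  shows "polypred (\<lambda>I v. f I v = g I v)"
proof -
  have "polypred (\<lambda>I v. \<not> f I v < g I v \<and> \<not> g I v < f I v)"
    by (intro polypred_conj polypred_not polypred_less assms)
  moreover have "\<not> a < b \<and> \<not> b < a \<longleftrightarrow> a = b" for a b :: nat
    by auto
  ultimately show ?thesis
    by simp
qed

lemma polyfun_if:
  assumes "polypred P" "polyfun f" "polyfun g"
  shows "polyfun (\<lambda>I v. if P I v then f I v else g I v)"
proof -
  have "polyfun (\<lambda>I v. (if P I v then 1 else 0) * f I v + (1 - (if P I v then 1 else 0)) * g I v)"
    by (intro polyfun_add polyfun_mult polyfun_diff polyfun_const assms[unfolded polypred_def])
  moreover have "(if p then 1 else 0) * a + (1 - (if p then 1 else 0)) * b = (if p then a else b)"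
    for p and a b :: nat
    by simp
  ultimately show ?thesis
    by (simp only:)
qed

text \<open>The quotient counts the positive multiples of \<open>b\<close> up to \<open>a\<close>;
  there are at most \<open>a\<close> of them, so a sum bounded by \<open>a\<close> suffices.\<close>

lemma div_eq_sum:
  fixes a b :: nat
  shows "a div b = (\<Sum>i<a. if 0 < b \<and> (i + 1) * b < a + 1 then 1 else 0)"
proof (cases "b = 0")
  case False
  have "(\<Sum>i<a. if 0 < b \<and> (i + 1) * b < a + 1 then 1 else 0) =
      (\<Sum>i | i \<in> {..<a} \<and> 0 < b \<and> (i + 1) * b < a + 1. (1::nat))"
    by (rule sum.inter_filter[symmetric]) simp
  also have "{i. i \<in> {..<a} \<and> 0 < b \<and> (i + 1) * b < a + 1} = {..<a div b}"
  proof -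
    have "(i + 1) * b < a + 1 \<longleftrightarrow> i < a div b" for i
    proof -
      have "(i + 1) * b < a + 1 \<longleftrightarrow> (i + 1) * b \<le> a"
        by linarith
      also have "\<dots> \<longleftrightarrow> i + 1 \<le> a div b"
        using False less_eq_div_iff_mult_less_eq[of b "i + 1" a] by blast
      finally show ?thesis
        by linarith
    qed
    moreover have "a div b \<le> a"
      by simp
    ultimately show ?thesis
      using False by (auto simp only: neq0_conv lessThan_iff intro: order_less_le_trans)
  qed
  finally show ?thesis
    by simp
qed simp

lemma polyfun_div:
  assumes "polyfun f" "polyfun g"
  shows "polyfun (\<lambda>I v. f I v div g I v)"
  unfolding div_eq_sum
proof (rule polyfun_sum[OF assms(1)])
  show "polyfun (\<lambda>I v. if 0 < g I v \<and> (v x + 1) * g I v < f I v + 1 then 1 else 0)" for x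
    by (intro polyfun_if polypred_conj polypred_less polyfun_mult polyfun_add polyfun_const polyfun_var assms)
next
  obtain y where "\<And>x I v i. y \<le> x \<Longrightarrow> f I (v(x := i)) = f I v" "\<And>x I v i. y \<le> x \<Longrightarrow> g I (v(x := i)) = g I v"
    using polyfun_fresh2[OF assms] by blast
  then show "\<exists>y. \<forall>x\<ge>y. \<forall>I v i j.
      (if 0 < g I (v(x := i)) \<and> (j + 1) * g I (v(x := i)) < f I (v(x := i)) + 1 then 1 else 0) =
      (if 0 < g I v \<and> (j + 1) * g I v < f I v + 1 then 1 else 0)"
    by (intro exI[of _ y] allI impI) (simp only:)
qed

lemma polyfun_mod:
  assumes "polyfun f" "polyfun g"
  shows "polyfun (\<lambda>I v. f I v mod g I v)"
  unfolding minus_div_mult_eq_mod[symmetric]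
  by (intro polyfun_diff polyfun_mult polyfun_div assms)

lemmas polyfun_intros = polyfun_const polyfun_var polyfun_inp polyfun_add polyfun_diff polyfun_mult
  polyfun_div polyfun_mod polyfun_if polypred_less polypred_not polypred_conj polypred_disj polypred_eq

lemma polyfun_power: "polyfun f \<Longrightarrow> polyfun (\<lambda>I v. f I v ^ c)"
  by (induction c) (auto intro!: polyfun_const polyfun_mult)

lemma polyfun_hub_count: "polyfun k \<Longrightarrow> polyfun (\<lambda>I v. hub_count (k I v))"
  unfolding hub_count_def by (intro polyfun_intros)

lemma polyfun_max_load: "polyfun n \<Longrightarrow> polyfun k \<Longrightarrow> polyfun (\<lambda>I v. max_load (n I v) (k I v))"
  unfolding max_load_def by (intro polyfun_intros polyfun_hub_count)

lemma polyfun_item_count: "polyfun n \<Longrightarrow> polyfun k \<Longrightarrow> polyfun (\<lambda>I v. item_count (n I v) (k I v))"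
  unfolding item_count_def by (intro polyfun_intros polyfun_hub_count)

lemma polyfun_vertex_count: "polyfun n \<Longrightarrow> polyfun k \<Longrightarrow> polyfun (\<lambda>I v. vertex_count (n I v) (k I v))"
  unfolding vertex_count_def by (intro polyfun_intros polyfun_hub_count polyfun_item_count)

text \<open>The matrix starts behind the \<open>n + 1\<close> cells of the unary prefix, and 2 is
  the cell code of \<open>True\<close>.\<close>

definition input_adjacent :: "nat \<Rightarrow> (nat \<Rightarrow> nat) \<Rightarrow> nat \<Rightarrow> nat \<Rightarrow> bool" where
  "input_adjacent n I a b \<longleftrightarrow> I (n + 1 + (a * n + b)) = 2"

lemma polyfun_padded_weight:
  assumes "polyfun n" "polyfun k" "polyfun t" "polyfun d" "polyfun h"
  shows "polyfun (\<lambda>I v. padded_weight (n I v) (k I v) (input_adjacent (n I v) I) (t I v) (d I v) (h I v))"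
  unfolding padded_weight_def item_weight_def Let_def input_adjacent_def
  by (intro polyfun_intros polyfun_max_load assms)

lemma polyfun_reduction_weight:
  "polyfun (\<lambda>I v. reduction_weight (v 0) (v 1) (input_adjacent (v 0) I) (v 2) (v 3))"
  unfolding reduction_weight_def gadget_weight_def arc_weight_def
  by (intro polyfun_intros polyfun_padded_weight polyfun_hub_count polyfun_item_count polyfun_max_load)

subsection \<open>The reduction program\<close>

text \<open>The driver reads its input where a preceding program left its output.  It copies the string to
  the blank array \<open>m\<close>, because array 2 may contain garbage behind the terminating zero and because the
  new output goes there, and scans the unary prefix.\<close>

abbreviation "increment a \<equiv> Assign a (Const 0) (Plus (cell a 0) (Const 1))"

definition driver :: "nat \<Rightarrow> oexp \<Rightarrow> fexp \<Rightarrow> com" where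
  "driver m p e =
     Seq (WhileNZ (Cell 2 (cell (m + 1) 0))
       (Seq (Assign m (cell (m + 1) 0) (Cell 2 (cell (m + 1) 0))) (increment (m + 1))))
     (Seq (Assign (m + 1) (Const 0) (Const 0))
     (Seq (WhileNZ (Minus (Cell m (cell (m + 1) 0)) (Const 1)) (increment (m + 1)))
     (Seq (Assign (m + 1) (Const 1) (cell 3 0))
     (Seq (ocomp m 0 p)
     (Seq (Assign 2 (cell (m + 3) 0) (Const 0))
     (Seq (fcomp m 0 e) (Assign 3 (Const 0) (cell (m + 2) 0))))))))"

text \<open>The scan stops at the first cell with value 1, which ends the unary prefix, and so finds
  \<open>n\<close>. The constant 6 consists of the final tests of the two loops and four single
  assignments.\<close>

lemma driver_correct:
  assumes m: "4 \<le> m" and blank: "\<And>a. m \<le> a \<Longrightarrow> s a = (\<lambda>i. 0)"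
    and input: "\<And>i. i \<le> length x \<Longrightarrow> s 2 i = string_cell x i" "s 3 0 = k"
    and prefix: "n < length x" "\<And>i. i < n \<Longrightarrow> string_cell x i = 2" "string_cell x n = 1"
  defines "v \<equiv> (\<lambda>i. 0)(0 := n, 1 := k)"
  shows "runs (driver m p e) s
     (3 * length x + 2 * n + 6 + ocost p (string_cell x) v + fcost e (string_cell x) v)
     (\<lambda>s'. has_output s' (oeval p (string_cell x) v) (feval e (string_cell x) v))"
proof -
  let ?I = "string_cell x"
  define J where "J i s' \<longleftrightarrow> (\<forall>a. a \<noteq> m \<and> a \<noteq> m + 1 \<longrightarrow> s' a = s a) \<and>
    s' m = (\<lambda>j. if j < i then ?I j else 0) \<and> s' (m + 1) = (\<lambda>j. 0)(0 := i)" for i s'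
  define K where "K i s' \<longleftrightarrow> (\<forall>a. a \<noteq> m \<and> a \<noteq> m + 1 \<longrightarrow> s' a = s a) \<and>
    s' m = ?I \<and> s' (m + 1) = (\<lambda>j. 0)(0 := i)" for i s'
  have nonzero: "?I i \<noteq> 0" if "i < length x" for i
    using that by (simp add: string_cell_def)
  \<comment> \<open>The cells behind a string are 0, as are those of a blank array, so copying the
    string reproduces all of \<open>?I\<close>.\<close>
  have copied: "(\<lambda>j. if j < length x then ?I j else 0) = ?I"
    by (auto simp: string_cell_def)
  have copy: "runs (WhileNZ (Cell 2 (cell (m + 1) 0))
       (Seq (Assign m (cell (m + 1) 0) (Cell 2 (cell (m + 1) 0))) (increment (m + 1)))) s
       (1 + (\<Sum>i<length x. 1 + (1 + 1))) (J (length x))"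
  proof (rule runs_While[where I = J])
    show "J 0 s"
      using blank by (auto simp: J_def)
  next
    fix i s' assume i: "i < length x" and J: "J i s'"
    have "s' 2 i = ?I i"
      using J input(1)[of i] i m by (simp add: J_def)
    then show "aval (Cell 2 (cell (m + 1) 0)) s' \<noteq> 0 \<and>
        runs (Seq (Assign m (cell (m + 1) 0) (Cell 2 (cell (m + 1) 0))) (increment (m + 1))) s' (1 + 1) (J (Suc i))"
      using J nonzero[OF i] m
      by (intro conjI runs_Seq runs_Assign) (auto simp: J_def fun_eq_iff less_Suc_eq)
  next
    fix s' assume "J (length x) s'"
    then show "aval (Cell 2 (cell (m + 1) 0)) s' = 0 \<and> J (length x) s'"
      using input(1)[of "length x"] m by (simp add: J_def string_cell_def)
  qed
  have scan: "runs (WhileNZ (Minus (Cell m (cell (m + 1) 0)) (Const 1)) (increment (m + 1))) s'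
      (1 + (\<Sum>i<n. 1 + 1)) (K n)" if "K 0 s'" for s'
  proof (rule runs_While[where I = K])
    fix i s' assume i: "i < n" and K: "K i s'"
    show "aval (Minus (Cell m (cell (m + 1) 0)) (Const 1)) s' \<noteq> 0 \<and> runs (increment (m + 1)) s' 1 (K (Suc i))"
      using K prefix(2)[OF i] by (intro conjI runs_Assign) (auto simp: K_def)
  next
    fix s' assume "K n s'"
    then show "aval (Minus (Cell m (cell (m + 1) 0)) (Const 1)) s' = 0 \<and> K n s'"
      using prefix(3) by (simp add: K_def)
  qed (rule that)
  have emit: "runs (Seq (ocomp m 0 p)
     (Seq (Assign 2 (cell (m + 3) 0) (Const 0))
     (Seq (fcomp m 0 e) (Assign 3 (Const 0) (cell (m + 2) 0))))) s'
     (ocost p ?I v + (1 + (fcost e ?I v + 1))) (\<lambda>s'. has_output s' (oeval p ?I v) (feval e ?I v))"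
    if s': "s' m = ?I" "s' (m + 1) = v" "s' (m + 3) 0 = 0" for s'
  proof -
    have "outputs m s' []"
      using s' by (simp add: outputs_def)
    then have emitted: "runs (ocomp m 0 p) s' (ocost p ?I v)
        (\<lambda>s1. frame {2, m + 3} m 0 s' s1 \<and> outputs m s1 ([] @ oeval p ?I v))"
      using ocomp_correct[of m s' "[]" 0 p] m s' by simp
    show ?thesis
    proof (rule runs_Seq, rule runs_mono[OF emitted le_refl])
      fix s1 assume s1: "frame {2, m + 3} m 0 s' s1 \<and> outputs m s1 ([] @ oeval p ?I v)"
      let ?ys = "oeval p ?I v" and ?s2 = "s1(2 := (s1 2)(length (oeval p ?I v) := 0))"
      have len: "s1 (m + 3) 0 = length ?ys"
        using s1 by (simp add: outputs_def)
      have s2: "?s2 m = ?I" "?s2 (m + 1) = v" "\<And>i. i \<le> length ?ys \<Longrightarrow> ?s2 2 i = string_cell ?ys i"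
        using s1 s' m by (auto simp: frame_def outputs_def string_cell_def)
      have "runs (fcomp m 0 e) ?s2 (fcost e ?I v)
          (\<lambda>s'. frame {} m 0 ?s2 s' \<and> s' (m + 2) 0 = feval e ?I v)"
        using fcomp_correct[of m 0 e ?s2] unfolding s2 .
      then have rest: "runs (Seq (fcomp m 0 e) (Assign 3 (Const 0) (cell (m + 2) 0))) ?s2 (fcost e ?I v + 1)
          (\<lambda>s'. has_output s' ?ys (feval e ?I v))"
        by (intro runs_Seq, elim runs_mono[OF _ le_refl], intro runs_Assign)
          (use s2(3) m in \<open>auto simp: has_output_def frame_def\<close>)
      show "runs (Seq (Assign 2 (cell (m + 3) 0) (Const 0))
         (Seq (fcomp m 0 e) (Assign 3 (Const 0) (cell (m + 2) 0)))) s1 (1 + (fcost e ?I v + 1))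
         (\<lambda>s'. has_output s' ?ys (feval e ?I v))"
        by (rule runs_Seq, rule runs_Assign) (use rest in \<open>simp add: len\<close>)
    qed
  qed
  show ?thesis
    unfolding driver_def
  proof (rule runs_mono[OF runs_Seq, OF runs_mono[OF copy le_refl]], rule runs_Seq, rule runs_Assign,
      rule runs_Seq, rule runs_mono[OF scan le_refl])
    fix s' assume "J (length x) s'"
    then show "K 0 (s'(m + 1 := (s' (m + 1))(aval (Const 0) s' := aval (Const 0) s')))"
      by (auto simp: J_def K_def copied)
  next
    fix s' assume K: "K n s'"
    have "s' 3 0 = k" "s' (m + 3) 0 = 0"
      using K input(2) blank[of "m + 3"] m by (auto simp: K_def)
    then show "runs (Seq (Assign (m + 1) (Const 1) (cell 3 0)) (Seq (ocomp m 0 p)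
     (Seq (Assign 2 (cell (m + 3) 0) (Const 0))
     (Seq (fcomp m 0 e) (Assign 3 (Const 0) (cell (m + 2) 0)))))) s'
     (1 + (ocost p ?I v + (1 + (fcost e ?I v + 1)))) (\<lambda>s'. has_output s' (oeval p ?I v) (feval e ?I v))"
      using K by (intro runs_Seq runs_Assign emit) (auto simp: K_def v_def)
  qed simp_all
qed

section \<open>Composition of computable parameter functions\<close>

lemma initial_blank: "2 \<le> a \<Longrightarrow> initial x k a = (\<lambda>i. 0)"
  by (auto simp: initial_def)

lemma initial_empty: "initial [] k = (\<lambda>a i. if a = 1 \<and> i = 0 then k else 0)"
  by (auto simp: initial_def string_cell_def fun_eq_iff)

text \<open>The programs run on relocated copies of the memory: \<open>p\<close>, moved by 4, spares
  the input in array 1; \<open>q\<close>, moved by \<open>a\<close>, spares the result of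
  \<open>p\<close>; and \<open>h\<close> is evaluated from array \<open>b\<close> on with both
  results as variables.\<close>

lemma computable_combine:
  assumes "computable f" "computable g" and h: "polyfun (\<lambda>I v. h (v 0) (v 1))"
  shows "computable (\<lambda>k. h (f k) (g k))"
proof -
  obtain p where p: "\<And>k. \<exists>t s. exec p (initial [] k) t s \<and> s 3 0 = f k"
    using assms(1) unfolding computable_def by blast
  obtain q where q: "\<And>k. \<exists>t s. exec q (initial [] k) t s \<and> s 3 0 = g k"
    using assms(2) unfolding computable_def by blast
  obtain e where e: "\<And>I v. feval e I v = h (v 0) (v 1)"
    using polyfunE[OF h] by blast
  \<comment> \<open>Beyond everything the relocated \<open>p\<close> writes, and in any case beyond
    array 7, which is its output array 3 moved by 4.\<close>
  define a where "a = written_bound p + 8"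
  define b where "b = a + written_bound q + 4"
  let ?c = "Seq (Assign 5 (Const 0) (cell 1 0)) (Seq (shift_com 4 p)
     (Seq (Assign (a + 1) (Const 0) (cell 1 0)) (Seq (shift_com a q)
     (Seq (Assign (b + 1) (Const 0) (cell 7 0)) (Seq (Assign (b + 1) (Const 1) (cell (a + 3) 0))
     (Seq (fcomp b 0 e) (Assign 3 (Const 0) (cell (b + 2) 0))))))))"
  have "\<exists>t s. exec ?c (initial [] k) t s \<and> s 3 0 = h (f k) (g k)" for k
  proof -
    obtain t1 s1 where s1: "exec p (initial [] k) t1 s1" "s1 3 0 = f k"
      using p by blast
    obtain t2 s2 where s2: "exec q (initial [] k) t2 s2" "s2 3 0 = g k"
      using q by blast
    let ?r0 = "initial [] k"
    let ?r1 = "?r0(5 := (?r0 5)(0 := k))"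
    have "(\<lambda>a. ?r1 (a + 4)) = ?r0"
      by (auto simp: initial_empty fun_eq_iff)
    from exec_shift[OF s1(1) this] obtain r2 where r2: "exec (shift_com 4 p) ?r1 t1 r2"
        "(\<lambda>a. r2 (a + 4)) = s1" "\<forall>a<4. r2 a = ?r1 a"
      by blast
    have r2_high: "r2 c = s1 (c - 4)" if "4 \<le> c" for c
      using fun_cong[OF r2(2), of "c - 4"] that by simp
    have r2_blank: "r2 c = (\<lambda>i. 0)" if "a \<le> c" for c
      using that r2_high[of c] exec_unwritten[OF s1(1), of "c - 4"] initial_blank[of "c - 4"]
      by (simp add: a_def)
    have r2_k: "r2 1 0 = k"
      using r2(3) by (simp add: initial_empty)
    have r2_f: "r2 7 0 = f k"
      using r2_high[of 7] s1(2) by simp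
    let ?r3 = "r2(a + 1 := (r2 (a + 1))(0 := k))"
    have "(\<lambda>c. ?r3 (c + a)) = ?r0"
      by (auto simp: initial_empty fun_eq_iff r2_blank)
    from exec_shift[OF s2(1) this] obtain r4 where r4: "exec (shift_com a q) ?r3 t2 r4"
        "(\<lambda>c. r4 (c + a)) = s2" "\<forall>c<a. r4 c = ?r3 c"
      by blast
    have r4_high: "r4 c = s2 (c - a)" if "a \<le> c" for c
      using fun_cong[OF r4(2), of "c - a"] that by simp
    have r4_blank: "r4 c = (\<lambda>i. 0)" if "b \<le> c" for c
      using that r4_high[of c] exec_unwritten[OF s2(1), of "c - a"] initial_blank[of "c - a"]
      by (simp add: b_def)
    have r4_f: "r4 7 0 = f k"
      using r4(3) r2_f by (simp add: a_def)
    have r4_g: "r4 (a + 3) 0 = g k"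
      using r4_high[of "a + 3"] s2(2) by simp
    let ?r5 = "r4(b + 1 := (r4 (b + 1))(0 := f k))"
    let ?r6 = "?r5(b + 1 := (?r5 (b + 1))(1 := g k))"
    obtain t6 r7 where r7: "exec (fcomp b 0 e) ?r6 t6 r7" "r7 (b + 2) 0 = feval e (?r6 b) (?r6 (b + 1))"
      using fcomp_correct[of b 0 e ?r6] unfolding runs_def by blast
    let ?r8 = "r7(3 := (r7 3)(0 := r7 (b + 2) 0))"
    have step1: "exec (Assign 5 (Const 0) (cell 1 0)) ?r0 1 ?r1"
      using exec.Assign[of 5 "Const 0" "cell 1 0" ?r0] by (simp add: initial_empty)
    have step3: "exec (Assign (a + 1) (Const 0) (cell 1 0)) r2 1 ?r3"
      using exec.Assign[of "a + 1" "Const 0" "cell 1 0" r2] by (simp only: aval.simps r2_k)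
    have step5: "exec (Assign (b + 1) (Const 0) (cell 7 0)) r4 1 ?r5"
      using exec.Assign[of "b + 1" "Const 0" "cell 7 0" r4] by (simp only: aval.simps r4_f)
    have "?r5 (a + 3) 0 = g k"
      using r4_g by (simp add: b_def)
    then have step6: "exec (Assign (b + 1) (Const 1) (cell (a + 3) 0)) ?r5 1 ?r6"
      using exec.Assign[of "b + 1" "Const 1" "cell (a + 3) 0" ?r5] by (simp only: aval.simps)
    have step8: "exec (Assign 3 (Const 0) (cell (b + 2) 0)) r7 1 ?r8"
      using exec.Assign[of 3 "Const 0" "cell (b + 2) 0" r7] by (simp only: aval.simps)
    have "?r8 3 0 = h (f k) (g k)"
      using r7(2) by (simp add: e)
    moreover have "exec ?c ?r0 (1 + (t1 + (1 + (t2 + (1 + (1 + (t6 + 1))))))) ?r8"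
      by (intro exec.Seq[OF step1] exec.Seq[OF r2(1)] exec.Seq[OF step3] exec.Seq[OF r4(1)]
          exec.Seq[OF step5] exec.Seq[OF step6] exec.Seq[OF r7(1)] step8)
    ultimately show ?thesis
      by blast
  qed
  then show ?thesis
    unfolding computable_def by blast
qed

text \<open>Variables 0 to 3 hold \<open>n\<close>, \<open>k\<close>, the row and the column, so the
  loop counter is variable 4.\<close>

abbreviation "emit_unary e \<equiv> OSeq (OFor 4 e (Emit (Num 1))) (Emit (Num 0))"

lemma oeval_emit_unary: "oeval (emit_unary e) I v = unary (feval e I v)"
proof -
  have "concat (map (\<lambda>i. [True]) [0..<n]) = replicate n True" for n :: nat
    by (induction n) (auto simp: replicate_append_same)
  then show ?thesis
    by (simp add: unary_def)
qed

lemma oeval_matrix: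
  "oeval (OSeq p (OSeq (OFor x e (OFor y e' q)) r)) I v = oeval p I v @
     concat (map (\<lambda>i. concat (map (\<lambda>j. oeval q I (v(x := i, y := j)))
       [0..<feval e' I (v(x := i))])) [0..<feval e I v]) @ oeval r I v"
  by simp

lemma reduction_program:
  "\<exists>p. \<forall>n k x. oeval p (string_cell x) ((\<lambda>i. 0)(0 := n, 1 := k)) =
     encode_weighted_graph (vertex_count n k)
       (edges_of (vertex_count n k) (reduction_weight n k (input_adjacent n (string_cell x))))
       (weight_of (reduction_weight n k (input_adjacent n (string_cell x)))) @ binary (max_load n k)"
proof -
  obtain eN where eN: "\<And>I v. feval eN I v = vertex_count (v 0) (v 1)"
    using polyfunE[OF polyfun_vertex_count[OF polyfun_var polyfun_var]] by blast
  obtain eR where eR: "\<And>I v. feval eR I v = max_load (v 0) (v 1)"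
    using polyfunE[OF polyfun_max_load[OF polyfun_var polyfun_var]] by blast
  obtain eW where eW: "\<And>I v. feval eW I v = reduction_weight (v 0) (v 1) (input_adjacent (v 0) I) (v 2) (v 3)"
    using polyfunE[OF polyfun_reduction_weight] by blast
  have "oeval (OSeq (emit_unary eN) (OSeq (OFor 2 eN (OFor 3 eN (emit_unary eW))) (OBin eR)))
      (string_cell x) ((\<lambda>i. 0)(0 := n, 1 := k)) =
     encode_weighted_graph (vertex_count n k)
       (edges_of (vertex_count n k) (reduction_weight n k (input_adjacent n (string_cell x))))
       (weight_of (reduction_weight n k (input_adjacent n (string_cell x)))) @ binary (max_load n k)" for n k x
  proof -
    let ?N = "vertex_count n k" and ?W = "reduction_weight n k (input_adjacent n (string_cell x))"
    have W: "symmetric_weights ?W"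
      by (simp add: reduction_weight_def symmetric_gadget_weight)
    have "(if {i, j} \<in> edges_of ?N ?W then weight_of ?W {i, j} else 0) = ?W i j" if "i < ?N" "j < ?N" for i j
      using that by (simp add: edges_of_iff[OF W] weight_of_edge[OF W])
    then have "encode_weighted_graph ?N (edges_of ?N ?W) (weight_of ?W) =
        unary ?N @ concat (map (\<lambda>i. concat (map (\<lambda>j. unary (?W i j)) [0..<?N])) [0..<?N])"
      unfolding encode_weighted_graph_def by (auto intro!: arg_cong[of _ _ concat] map_cong)
    then show ?thesis
      unfolding oeval_matrix oeval_emit_unary oeval.simps(4) by (simp add: eN eR eW)
  qed
  then show ?thesis
    by blast
qed

lemma reduction_bound:
  fixes t l n cost1 cost2 B :: nat
  assumes "3 \<le> B" "t \<le> B" "l \<le> B" "n \<le> B" "cost1 \<le> B ^ c1" "cost2 \<le> B ^ c2"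
  shows "t + (3 * l + 2 * n + 6 + cost1 + cost2) \<le> B ^ (c1 + c2 + 4)"
proof -
  have "B ^ c1 \<le> B ^ (c1 + c2 + 1)" "B ^ c2 \<le> B ^ (c1 + c2 + 1)" "B ^ 1 \<le> B ^ (c1 + c2 + 1)"
    using assms(1) by (intro power_increasing; simp)+
  \<comment> \<open>Since \<open>6 \<le> 2 * B\<close>, ten copies of the power suffice; the factor
    is rounded up to 27, the power of 3 absorbed by \<open>B ^ 3\<close>.\<close>
  then have "t + (3 * l + 2 * n + 6 + cost1 + cost2) \<le> 27 * B ^ (c1 + c2 + 1)"
    using assms unfolding power_one_right by linarith
  also have "\<dots> \<le> B ^ 3 * B ^ (c1 + c2 + 1)"
    using power_mono[OF assms(1), of 3] by (intro mult_right_mono) auto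
  also have "\<dots> = B ^ (c1 + c2 + 4)"
    by (simp only: power_add[symmetric]) (simp add: add_ac)
  finally show ?thesis .
qed

theorem theorem5: "W1_hard MIN_MAX_OUTDEGREE_treewidth"
proof -
  obtain p where p: "\<And>n k x. oeval p (string_cell x) ((\<lambda>i. 0)(0 := n, 1 := k)) =
     encode_weighted_graph (vertex_count n k)
       (edges_of (vertex_count n k) (reduction_weight n k (input_adjacent n (string_cell x))))
       (weight_of (reduction_weight n k (input_adjacent n (string_cell x)))) @ binary (max_load n k)"
    using reduction_program by blast
  have "polyfun (\<lambda>I v. hub_count (v 1) + 1)"
    by (intro polyfun_intros polyfun_hub_count)
  then obtain e where e: "\<And>I v. feval e I v = hub_count (v 1) + 1"
    using polyfunE by blast
  obtain c1 where c1: "\<And>B I v. 2 \<le> B \<Longrightarrow> (\<And>i. I i \<le> B) \<Longrightarrow> (\<And>x. v x \<le> B) \<Longrightarrow> ocost p I v \<le> B ^ c1"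
    using poly_boundedE[OF poly_bounded_ocost[of p]] by blast
  obtain c2 where c2: "\<And>B I v. 2 \<le> B \<Longrightarrow> (\<And>i. I i \<le> B) \<Longrightarrow> (\<And>x. v x \<le> B) \<Longrightarrow> fcost e I v \<le> B ^ c2"
    using poly_boundedE[OF poly_bounded_fcost[of e]] by blast
  define d where "d = c1 + c2 + 4"
  have "fpt_reduces P MIN_MAX_OUTDEGREE_treewidth" if "fpt_reduces P CLIQUE" for P
  proof -
    obtain f g c C q where f: "computable f" and g: "computable g" and
      q: "\<And>x k. (x, k) \<in> instances P \<Longrightarrow> \<exists>t s x'. exec q (initial x k) t s \<and>
           t \<le> C * (f k * (length x + 1) ^ c) \<and> has_output s x' (g k) \<and> (x', g k) \<in> instances CLIQUE \<and>
           ((x, k) \<in> yes_instances P \<longleftrightarrow> (x', g k) \<in> yes_instances CLIQUE)"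
      using \<open>fpt_reduces P CLIQUE\<close> unfolding fpt_reduces_def by fast
    \<comment> \<open>Arrays from \<open>m\<close> on are still blank after \<open>q\<close> has
      run, and the four input and output arrays lie below.\<close>
    define m where "m = max 4 (written_bound q)"
    have "polyfun (\<lambda>I v. (v 0 + v 1 + 3) ^ d)"
      by (intro polyfun_power polyfun_intros)
    then have f': "computable (\<lambda>k. (f k + g k + 3) ^ d)"
      by (rule computable_combine[OF f g])
    have g': "computable (\<lambda>k. hub_count (g k) + 1)"
      by (rule computable_combine[OF g g]) (intro polyfun_intros polyfun_hub_count)
    have "\<exists>t s y. exec (Seq q (driver m p e)) (initial x k) t s \<and>
           t \<le> (C + 1) ^ d * ((f k + g k + 3) ^ d * (length x + 1) ^ (c * d)) \<and>
           has_output s y (hub_count (g k) + 1) \<and>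
           (y, hub_count (g k) + 1) \<in> instances MIN_MAX_OUTDEGREE_treewidth \<and>
           ((x, k) \<in> yes_instances P \<longleftrightarrow> (y, hub_count (g k) + 1) \<in> yes_instances MIN_MAX_OUTDEGREE_treewidth)"
      if xk: "(x, k) \<in> instances P" for x k
    proof -
      obtain t s x' where s: "exec q (initial x k) t s" "t \<le> C * (f k * (length x + 1) ^ c)"
          "has_output s x' (g k)" "(x', g k) \<in> instances CLIQUE"
          "(x, k) \<in> yes_instances P \<longleftrightarrow> (x', g k) \<in> yes_instances CLIQUE"
        using q[OF xk] by blast
      \<comment> \<open>Unique decoding of CLIQUE instances is avoided here. For a yes-instance the
        graph that witnesses this is taken; otherwise any graph encoded by \<open>x'\<close> lacks
        the clique, since it would make the pair a yes-instance.\<close>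
      have inst: "\<exists>n E. simple_graph {0..<n} E \<and> x' = encode_graph n E \<and> ((x', g k) \<in> yes_instances CLIQUE \<longleftrightarrow>
          (\<exists>S. S \<subseteq> {0..<n} \<and> card S = g k \<and> clique E S))"
      proof (cases "(x', g k) \<in> yes_instances CLIQUE")
        case True
        then show ?thesis
          by (auto simp: CLIQUE_def)
      next
        case False
        moreover obtain n E where "simple_graph {0..<n} E" "x' = encode_graph n E"
          using s(4) by (auto simp: CLIQUE_def)
        ultimately show ?thesis
          by (intro exI[of _ n] exI[of _ E]) (auto simp: CLIQUE_def)
      qed
      then obtain n E where E: "simple_graph {0..<n} E" and x': "x' = encode_graph n E"
        and yes: "(x', g k) \<in> yes_instances CLIQUE \<longleftrightarrow> (\<exists>S. S \<subseteq> {0..<n} \<and> card S = g k \<and> clique E S)"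
        by blast
      note cells = encode_graph_cells[where n = n and E = E, folded x']
      let ?I = "string_cell x'" and ?v = "(\<lambda>i. 0)(0 := n, 1 := g k)"
      let ?N = "vertex_count n (g k)" and ?W = "reduction_weight n (g k) (input_adjacent n (string_cell x'))"
      have W: "symmetric_weights ?W"
        by (simp add: reduction_weight_def symmetric_gadget_weight)
      define y where "y = encode_weighted_graph ?N (edges_of ?N ?W) (weight_of ?W) @ binary (max_load n (g k))"
      have tw: "treewidth {0..<?N} (edges_of ?N ?W) = hub_count (g k) + 1"
        unfolding vertex_count_def reduction_weight_def by (rule gadget_treewidth)
      have r: "0 < max_load n (g k)"
        by (simp add: max_load_def)
      have y_inst: "(y, hub_count (g k) + 1) \<in> instances MIN_MAX_OUTDEGREE_treewidth"
        unfolding y_def tw[symmetric]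
        by (intro instanceI simple_graph_edges_of[OF W] edge_weighting_edges_of[OF W] r)
      have "(y, hub_count (g k) + 1) \<in> yes_instances MIN_MAX_OUTDEGREE_treewidth \<longleftrightarrow>
          orientable ?N ?W (max_load n (g k))"
        unfolding y_def tw[symmetric]
        by (simp only: yes_instance_iff[OF simple_graph_edges_of[OF W] edge_weighting_edges_of[OF W] r]
            orientable_iff[OF W])
      also have "\<dots> \<longleftrightarrow> (\<exists>u. (\<forall>i<g k. u i < n) \<and> (\<forall>i<g k. \<forall>j<g k. i \<noteq> j \<longrightarrow> {u i, u j} \<in> E))"
        unfolding reduction_orientable_iff input_adjacent_def using cells(4) by (intro iff_exI) auto
      also have "\<dots> \<longleftrightarrow> (x, k) \<in> yes_instances P"
        using clique_iff_choice[OF E, of "g k"] yes s(5) by simp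
      finally have y_yes: "(x, k) \<in> yes_instances P \<longleftrightarrow>
          (y, hub_count (g k) + 1) \<in> yes_instances MIN_MAX_OUTDEGREE_treewidth"
        by simp
      have blank: "s a = (\<lambda>i. 0)" if "m \<le> a" for a
        using that exec_unwritten[OF s(1), of a] initial_blank[of a] by (simp add: m_def)
      have "runs (driver m p e) s (3 * length x' + 2 * n + 6 + ocost p ?I ?v + fcost e ?I ?v)
          (\<lambda>s'. has_output s' (oeval p ?I ?v) (feval e ?I ?v))"
        by (rule driver_correct[OF _ blank _ _ cells(1,2,3)]) (use s(3) in \<open>auto simp: m_def has_output_def\<close>)
      then obtain t' s' where s': "exec (driver m p e) s t' s'"
          "t' \<le> 3 * length x' + 2 * n + 6 + ocost p ?I ?v + fcost e ?I ?v"
          "has_output s' y (hub_count (g k) + 1)"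
        unfolding runs_def p e y_def by auto
      \<comment> \<open>Bounds all cells and variables the compiled expressions start from: cells
        are at most 2, and \<open>n < length x' \<le> t\<close>. The summand 3 meets the hypothesis
        of \<open>reduction_bound\<close>.\<close>
      let ?B = "t + g k + 3"
      have len: "length x' \<le> t"
      proof -
        have "finite {i. s 2 i \<noteq> 0}" "card {i. s 2 i \<noteq> 0} \<le> t"
          using exec_nonzero_cells[OF s(1), of 2] by (auto simp: initial_blank)
        moreover have "{..<length x'} \<subseteq> {i. s 2 i \<noteq> 0}"
          using s(3) by (auto simp: has_output_def string_cell_def)
        ultimately show ?thesis
          using card_mono[of "{i. s 2 i \<noteq> 0}" "{..<length x'}"] by simp
      qed
      have "?I i \<le> ?B" "?v i \<le> ?B" for i
        using len cells(1) by (auto simp: string_cell_def)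
      then have "ocost p ?I ?v \<le> ?B ^ c1" "fcost e ?I ?v \<le> ?B ^ c2"
        using c1[of ?B ?I ?v] c2[of ?B ?I ?v] by auto
      then have "t + t' \<le> ?B ^ d"
        using reduction_bound[of ?B t "length x'" n "ocost p ?I ?v" c1 "fcost e ?I ?v" c2] s'(2) len cells(1)
        unfolding d_def by linarith
      also have "\<dots> \<le> ((C + 1) * ((f k + g k + 3) * (length x + 1) ^ c)) ^ d"
      proof (rule power_mono)
        have "g k + 3 \<le> (g k + 3) * (length x + 1) ^ c"
          by simp
        then have "?B \<le> C * (f k * (length x + 1) ^ c) + (g k + 3) * (length x + 1) ^ c"
          using s(2) by linarith
        also have "\<dots> \<le> (C + 1) * ((f k + g k + 3) * (length x + 1) ^ c)"
          by (simp add: algebra_simps)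
        finally show "?B \<le> (C + 1) * ((f k + g k + 3) * (length x + 1) ^ c)" .
      qed simp
      also have "\<dots> = (C + 1) ^ d * ((f k + g k + 3) ^ d * (length x + 1) ^ (c * d))"
        by (simp only: power_mult_distrib power_mult)
      finally show ?thesis
        using exec.Seq[OF s(1) s'(1)] s'(3) y_inst y_yes by blast
    qed
    then show ?thesis
      unfolding fpt_reduces_def using f' g' by blast
  qed
  then show ?thesis
    by (simp add: W1_hard_def W1_def)
qed

end
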